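(* Let $H$ be a Hilbert space, $U_1,U_2: H \rightrightarrows H$ two maximal monotone operators and $c >0$. Given $(\alpha_n) \subset [0,1]$, $(\beta_n) \subset [-1,1]$, and $x_0, u \in H$, let $(x_n)$ be generated from $x_0$ by, for $n\in\mathbb{N}$, $$x_{2n+1}=(1-\alpha_n)x_{2n}+\alpha_nu,\quad y_n=J_{c U_2}(x_{2n+1}),\quad z_n=J_{c U_1}(2y_n-x_{2n+1}),\quad x_{2n+2}=x_{2n+1}+(1-\beta_n)(z_n-y_n).$$ Assume that $\Gamma_1,\Gamma_3,\Gamma_4:(0,+\infty)\to\mathbb{N}$ and $\Gamma_2:\mathbb{N}\to\mathbb{N}$ are monotone functions such that: (Q1) for all $\varepsilon>0$ and all $n\ge\Gamma_1(\varepsilon)$, $\alpha_n\le\varepsilon$; (Q2) for all $k\in\mathbb{N}$, $\sum_{i=0}^{\Gamma_2(k)}\alpha_i\ge k$; (Q3) for all $\varepsilon>0$ and $n\in\mathbb{N}$, $\sum_{i=\Gamma_3(\varepsilon)+1}^{\Gamma_3(\varepsilon)+n}|\alpha_{i+1}-\alpha_i|\le\varepsilon$; (Q4) for all $\varepsilon>0$ and $n\in\mathbb{N}$, $\sum_{i=\Gamma_4(\varepsilon)+1}^{\Gamma_4(\varepsilon)+n}|\beta_{i+1}-\beta_i|\le\varepsilon$. Assume that there exist $N \in \mathbb{N} \setminus\{0\}$ such that $N \geq \max\{\|x_0-p\|,2\|u-p\|\}$ for some $p \in \mathrm{Fix}(R_{cU_1}\circ R_{cU_2})$, and $\gamma \in(0,1]$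 satisfying $-1+\gamma\leq \beta_n\leq 1-\gamma$ for all $n\in \mathbb{N}$. Then: (i) $(x_n)$ converges strongly to $\overline{x}=P_{\mathrm{Fix}(R_{c U_1}\circ R_{c U_2})}(u)$ and $\mu_3:=\mu[N,\gamma/2,\Gamma_1, \Gamma_2, \Gamma_3, \Gamma_4]$ is a rate of metastability for $(x_n)$, where $\mu$ is the functional defined in the context; (ii) $(y_n)$ and $(z_n)$ converge strongly to $J_{cU_2}(\overline{x})\in \mathrm{zer}(U_1+U_2)$, and $$\mu_4(\varepsilon,f):=\mu_3(\varepsilon,2f+1), \qquad \mu_5(\varepsilon,f):=\mu_3(\varepsilon/3,2f+1)$$ are rates of metastability for $(y_n)$ and $(z_n)$, respectively.
   Context: $\mathrm{zer}(A)=\{x: 0\in A(x)\}$. A multi-valued operator $A:H\rightrightarrows H$ is monotone if $\langle x-x',y-y'\rangle\ge0$ for all $(x,y),(x',y')$ in its graph, and maximal monotone if its graph is not properly contained in the graph of another monotone operator. $J_{A}=(\mathrm{Id}+A)^{-1}$ is the (single-valued) resolvent and $R_A:=2J_A-\mathrm{Id}$ the reflected resolvent. $P_S$ is the metric projection onto the nonempty closed convex set $S$. Monotone functions: $\varepsilon\le\varepsilon'$ implies $\Gamma_i(\varepsilon)\ge\Gamma_i(\varepsilon')$ for $i=1,3,4$; $k\le k'$ implies $\Gamma_2(k)\le\Gamma_2(k')$. $2f+1$ denotes the function $n\mapsto 2f(n)+1$. A rate of metastability for a sequence $(w_n)$ in $H$ is a functional $M:(0,+\infty)\times\mathbb{N}^{\mathbb{N}}\to\mathbb{N}$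 such that for all $\varepsilon>0$ and $f:\mathbb{N}\to\mathbb{N}$ there is $n\le M(\varepsilon,f)$ with $\|w_i-w_j\|\le\varepsilon$ for all $i,j\in[n,f(n)]$, where $[n,m]=\{n,n+1,\dots,m\}$ (empty if $m<n$). $\lceil x\rceil$ denotes the maximum of $0$ and the usual ceiling of $x$. Definition of $\mu[N,\gamma',\Gamma_1,\Gamma_2,\Gamma_3,\Gamma_4]$ for $\gamma'\in(0,1)$ (above it is used with $\gamma'=\gamma/2$). For $\varepsilon>0$: $V(\varepsilon):=\max\{\Gamma_3(\tfrac{\varepsilon}{4N}),\Gamma_4(\tfrac{\varepsilon}{4N})\}$; $\theta_1(\varepsilon):=\Gamma_2\big(V(\tfrac{\varepsilon}{2})+\lceil\ln(\tfrac{4N}{\varepsilon})\rceil+2\big)+1$; $\theta_3(\varepsilon):=\max\{\theta_1(\tfrac{(\gamma'\varepsilon)^2}{8N}),\Gamma_1(\tfrac{(\gamma'\varepsilon)^2}{2N^2})\}$; $\theta_4(\varepsilon):=\max\{\theta_1(\tfrac\varepsilon2),\theta_3(\tfrac\varepsilon2)\}$; $\rho_2(\varepsilon):=2\theta_3(\tfrac\varepsilon3)+2$; $\rho_3(\varepsilon):=2\max\{\theta_4(\tfrac\varepsilon6),\Gamma_1(\tfrac{\varepsilon}{4N})\}+1$; $\rho(\varepsilon):=\max\{\rho_2(\varepsilon),\rho_3(\varepsilon)\}$. For $\delta:(0,1]\to(0,1]$: $\varphi(\varepsilon,\delta):=\min\{\delta^{(i)}(1):0\le i\le\lceil\tfrac{N^2}{4\varepsilon}\rceil\}$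 ($\delta^{(i)}$ the $i$-fold iterate), and $\Phi(\varepsilon,\delta):=\tfrac{1}{24N}\,\varphi(\tfrac{\varepsilon^2}{4N^2},\tilde\delta)^2$ with $\tilde\delta(\xi):=\min\{\delta(\tfrac{\xi^2}{24N}),\tfrac{\xi^2}{24N}\}$. For $\Delta:\mathbb{N}\to(0,1]$: $\Psi(\varepsilon,\Delta):=\rho(\Phi(\varepsilon,\overline\Delta))$ with $\overline\Delta(\eta):=\Delta(\rho(\eta))$ for $\eta\in(0,1]$. For given $\varepsilon>0$, $f:\mathbb{N}\to\mathbb{N}$: $\tilde\varepsilon:=\tfrac{\varepsilon^2}{16}$; $K(n):=\max\{n,\rho_3(\tfrac{\tilde\varepsilon}{36N})\}$; $\Sigma(n):=\Gamma_2\big(K(n)+\lceil\ln(\tfrac{12N^2}{\tilde\varepsilon})\rceil\big)+1$; $P(n):=f\big(2\max\{\Sigma(n),\theta_4(\tfrac\varepsilon4)\}+1\big)$; $\Delta_{\varepsilon,f}(n):=\min\{\tfrac{\tilde\varepsilon}{30N(P(n)+1)},1\}$; and $$\mu(\varepsilon,f):=2\max\{\Sigma(\Psi(\tfrac{\tilde\varepsilon}{24},\Delta_{\varepsilon,f})),\theta_4(\tfrac\varepsilon4)\}+1.$$ *)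

theory Defs
  imports "HOL-Analysis.Analysis"
begin

section \<open>Monotone operators\<close>

text \<open>A multi-valued operator on \<^typ>\<open>'a\<close> is a function \<^typ>\<open>'a \<Rightarrow> 'a set\<close>; the sum of two operator
  values is the Minkowski sum of \<^theory>\<open>HOL-Library.Set_Algebras\<close>.\<close>

definition graph_of :: "('a \<Rightarrow> 'a set) \<Rightarrow> ('a \<times> 'a) set" where
  "graph_of A = {(x, y). y \<in> A x}"

definition monotone_operator :: "('a::real_inner \<Rightarrow> 'a set) \<Rightarrow> bool" where
  "monotone_operator A \<longleftrightarrow>
     (\<forall>(x, y) \<in> graph_of A. \<forall>(x', y') \<in> graph_of A. (x - x') \<bullet> (y - y') \<ge> 0)"

definition maximal_monotone :: "('a::real_inner \<Rightarrow> 'a set) \<Rightarrow> bool" where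
  "maximal_monotone A \<longleftrightarrow>
     monotone_operator A \<and> \<not> (\<exists>B. monotone_operator B \<and> graph_of A \<subset> graph_of B)"

definition zer :: "('a::zero \<Rightarrow> 'a set) \<Rightarrow> 'a set" where
  "zer A = {x. 0 \<in> A x}"

definition scale_op :: "real \<Rightarrow> ('a::real_vector \<Rightarrow> 'a set) \<Rightarrow> 'a \<Rightarrow> 'a set" where
  "scale_op c A = (\<lambda>x. (\<lambda>y. c *\<^sub>R y) ` A x)"

text \<open>The set-valued inverse of \<open>Id + A\<close> at \<open>x\<close> is the set of all \<open>y\<close> with \<open>x \<in> {y} + A y\<close>. For maximal
  monotone \<open>A\<close> on a Hilbert space it is a singleton, and the resolvent is its element.\<close>

definition resolvent :: "('a::real_vector \<Rightarrow> 'a set) \<Rightarrow> 'a \<Rightarrow> 'a" where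
  "resolvent A x = (THE y. x \<in> {y} + A y)"

definition reflected_resolvent :: "('a::real_vector \<Rightarrow> 'a set) \<Rightarrow> 'a \<Rightarrow> 'a" where
  "reflected_resolvent A x = 2 *\<^sub>R resolvent A x - x"

definition Fix :: "('a \<Rightarrow> 'a) \<Rightarrow> 'a set" where
  "Fix T = {x. T x = x}"

text \<open>The constant \<^const>\<open>closest_point\<close> is restricted to Heine--Borel (hence finite-dimensional) spaces.\<close>

definition metric_projection :: "'a::metric_space set \<Rightarrow> 'a \<Rightarrow> 'a" where
  "metric_projection S x = (THE y. y \<in> S \<and> (\<forall>z\<in>S. dist x y \<le> dist x z))"


section \<open>Quantitative notions\<close>

definition rate_of_metastability ::
    "(real \<Rightarrow> (nat \<Rightarrow> nat) \<Rightarrow> nat) \<Rightarrow> (nat \<Rightarrow> 'a::real_normed_vector) \<Rightarrow> bool" where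
  "rate_of_metastability M w \<longleftrightarrow>
     (\<forall>\<epsilon>>0. \<forall>f :: nat \<Rightarrow> nat. \<exists>n \<le> M \<epsilon> f. \<forall>i \<in> {n..f n}. \<forall>j \<in> {n..f n}. norm (w i - w j) \<le> \<epsilon>)"

text \<open>Functions on \<open>(0, +\<infinity>)\<close> or \<open>(0, 1]\<close> are represented by functions on \<^typ>\<open>real\<close>, whose values
  elsewhere are not used. The rounding \<open>\<lceil>x\<rceil>\<close>, the maximum of \<open>0\<close> and the ceiling, is \<^term>\<open>nat \<lceil>x\<rceil>\<close>.\<close>

context
  fixes N :: nat and \<gamma>' :: real
    and \<Gamma>\<^sub>1 :: "real \<Rightarrow> nat" and \<Gamma>\<^sub>2 :: "nat \<Rightarrow> nat" and \<Gamma>\<^sub>3 :: "real \<Rightarrow> nat" and \<Gamma>\<^sub>4 :: "real \<Rightarrow> nat"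
begin

definition mu_V :: "real \<Rightarrow> nat" where
  "mu_V \<epsilon> = max (\<Gamma>\<^sub>3 (\<epsilon> / (4 * real N))) (\<Gamma>\<^sub>4 (\<epsilon> / (4 * real N)))"

definition mu_theta1 :: "real \<Rightarrow> nat" where
  "mu_theta1 \<epsilon> = \<Gamma>\<^sub>2 (mu_V (\<epsilon> / 2) + nat \<lceil>ln (4 * real N / \<epsilon>)\<rceil> + 2) + 1"

definition mu_theta3 :: "real \<Rightarrow> nat" where
  "mu_theta3 \<epsilon> = max (mu_theta1 ((\<gamma>' * \<epsilon>)\<^sup>2 / (8 * real N))) (\<Gamma>\<^sub>1 ((\<gamma>' * \<epsilon>)\<^sup>2 / (2 * (real N)\<^sup>2)))"

definition mu_theta4 :: "real \<Rightarrow> nat" where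
  "mu_theta4 \<epsilon> = max (mu_theta1 (\<epsilon> / 2)) (mu_theta3 (\<epsilon> / 2))"

definition mu_rho2 :: "real \<Rightarrow> nat" where
  "mu_rho2 \<epsilon> = 2 * mu_theta3 (\<epsilon> / 3) + 2"

definition mu_rho3 :: "real \<Rightarrow> nat" where
  "mu_rho3 \<epsilon> = 2 * max (mu_theta4 (\<epsilon> / 6)) (\<Gamma>\<^sub>1 (\<epsilon> / (4 * real N))) + 1"

definition mu_rho :: "real \<Rightarrow> nat" where
  "mu_rho \<epsilon> = max (mu_rho2 \<epsilon>) (mu_rho3 \<epsilon>)"

definition mu_phi :: "real \<Rightarrow> (real \<Rightarrow> real) \<Rightarrow> real" where
  "mu_phi \<epsilon> \<delta> = Min ((\<lambda>i. (\<delta> ^^ i) 1) ` {0..nat \<lceil>(real N)\<^sup>2 / (4 * \<epsilon>)\<rceil>})"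

definition mu_Phi :: "real \<Rightarrow> (real \<Rightarrow> real) \<Rightarrow> real" where
  "mu_Phi \<epsilon> \<delta> =
     1 / (24 * real N) *
     (mu_phi (\<epsilon>\<^sup>2 / (4 * (real N)\<^sup>2))
        (\<lambda>\<xi>. min (\<delta> (\<xi>\<^sup>2 / (24 * real N))) (\<xi>\<^sup>2 / (24 * real N))))\<^sup>2"

definition mu_Psi :: "real \<Rightarrow> (nat \<Rightarrow> real) \<Rightarrow> nat" where
  "mu_Psi \<epsilon> \<Delta> = mu_rho (mu_Phi \<epsilon> (\<lambda>\<eta>. \<Delta> (mu_rho \<eta>)))"

text \<open>In the following definitions \<open>\<epsilon>\<^sup>2 / 16\<close> is the quantity written \<open>\<epsilon>\<close> with a tilde in the literature.\<close>

definition mu_K :: "real \<Rightarrow> nat \<Rightarrow> nat" where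
  "mu_K \<epsilon> n = max n (mu_rho3 ((\<epsilon>\<^sup>2 / 16) / (36 * real N)))"

definition mu_Sigma :: "real \<Rightarrow> nat \<Rightarrow> nat" where
  "mu_Sigma \<epsilon> n = \<Gamma>\<^sub>2 (mu_K \<epsilon> n + nat \<lceil>ln (12 * (real N)\<^sup>2 / (\<epsilon>\<^sup>2 / 16))\<rceil>) + 1"

definition mu_P :: "real \<Rightarrow> (nat \<Rightarrow> nat) \<Rightarrow> nat \<Rightarrow> nat" where
  "mu_P \<epsilon> f n = f (2 * max (mu_Sigma \<epsilon> n) (mu_theta4 (\<epsilon> / 4)) + 1)"

definition mu_Delta :: "real \<Rightarrow> (nat \<Rightarrow> nat) \<Rightarrow> nat \<Rightarrow> real" where
  "mu_Delta \<epsilon> f n = min ((\<epsilon>\<^sup>2 / 16) / (30 * real N * (real (mu_P \<epsilon> f n) + 1))) 1"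

definition mu :: "real \<Rightarrow> (nat \<Rightarrow> nat) \<Rightarrow> nat" where
  "mu \<epsilon> f =
     2 * max (mu_Sigma \<epsilon> (mu_Psi ((\<epsilon>\<^sup>2 / 16) / 24) (mu_Delta \<epsilon> f))) (mu_theta4 (\<epsilon> / 4)) + 1"

end

end

theory Submission
  imports Defs
begin

text \<open>
  Write \<open>J\<^sub>i\<close> and \<open>R\<^sub>i\<close> for the resolvent and the reflected resolvent of \<open>c U\<^sub>i\<close>, and
  \<open>w\<^sub>n = x\<^sub>2\<^sub>n\<^sub>+\<^sub>1\<close>. Then \<open>z\<^sub>n - y\<^sub>n\<close> is half of \<open>T w\<^sub>n - w\<^sub>n\<close> for the nonexpansive map
  \<open>T = R\<^sub>1 \<circ> R\<^sub>2\<close>, so the iteration alternates a Halpern step towards \<open>u\<close> with a relaxed (Mann) step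
  \<open>x\<^sub>2\<^sub>n\<^sub>+\<^sub>2 = (1 - b\<^sub>n) T w\<^sub>n + b\<^sub>n w\<^sub>n\<close>, where \<open>b\<^sub>n = (1 + \<beta>\<^sub>n) / 2\<close> keeps the distance \<open>\<gamma> / 2\<close> from
  \<open>0\<close> and \<open>1\<close>. Everything about \<open>(x\<^sub>n)\<close> is proved for this iteration with any nonexpansive \<open>T\<close> that has a fixed point
  (locale \<open>halpern_mann\<close>); as \<open>J\<^sub>2\<close> and \<open>J\<^sub>1 \<circ> R\<^sub>2\<close> are nonexpansive, metastability and convergence pass
  from \<open>(w\<^sub>n)\<close> to \<open>y\<^sub>n = J\<^sub>2 w\<^sub>n\<close> and \<open>z\<^sub>n = J\<^sub>1 (R\<^sub>2 w\<^sub>n)\<close>.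

  That the resolvents are defined everywhere is Minty's theorem. Its proof here minimises the quadratic
  \<open>\<parallel>a - b\<parallel>\<^sup>2 / 4 + s\<close> over the convex hull of the points \<open>(a, b, a \<bullet> b)\<close> with \<open>(a, b)\<close> in the graph: by
  strong convexity the differences \<open>a - b\<close> of a minimising sequence converge, and the first order condition at the
  infimum says that half the limit is monotonically related to the whole graph (\<open>minty_for_monotone_sets\<close>).

  Metastability of \<open>(x\<^sub>n)\<close> has three ingredients. Asymptotic regularity: the increments
  \<open>\<parallel>x\<^sub>2\<^sub>n\<^sub>+\<^sub>2 - x\<^sub>2\<^sub>n\<parallel>\<close> contract by \<open>1 - \<alpha>\<^sub>n\<close> up to summable errors, which makes them small, and the strict
  convexity of the norm turns this into smallness of \<open>T x\<^sub>n - x\<^sub>n\<close> (\<open>even_increment_rate\<close>,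
  \<open>residual_rate\<close>). Approximate projection: among approximate fixed points in a fixed ball, the squared distance
  to \<open>u\<close> can be improved by a given amount only finitely often, which yields a point \<open>v\<close> that
  is as good a fixed point as desired and satisfies the variational inequality \<open>\<langle>u - v, x\<^sub>m - v\<rangle> \<le> \<epsilon>\<close> for all
  \<open>m\<close> beyond some \<open>n\<close> (\<open>anchor_along_iterates\<close>). Recurrence: with such a \<open>v\<close> the numbers
  \<open>\<parallel>x\<^sub>2\<^sub>k - v\<parallel>\<^sup>2\<close> again contract by \<open>1 - \<alpha>\<^sub>k\<close>, up to an error that accumulates linearly in the number of steps. As
  metastability only concerns indices up to \<open>f n\<close>, this number is known before \<open>v\<close> is chosen and the error can be
  made harmless (\<open>metastability\<close>).

  Metastability implies that \<open>(x\<^sub>n)\<close> is Cauchy. The limit is a fixed point by asymptotic regularity, and if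
  it violated \<open>\<parallel>u - q\<parallel> \<le> \<parallel>u - r\<parallel>\<close> for a fixed point \<open>r\<close>, then \<open>\<parallel>x\<^sub>2\<^sub>k - r\<parallel>\<^sup>2\<close> would eventually
  decrease by a multiple of \<open>\<alpha>\<^sub>k\<close> in each step, although the \<open>\<alpha>\<^sub>k\<close> have infinite sum (\<open>limit_closest\<close>). This
  gives existence of the projection of \<open>u\<close> onto the fixed points along the way.
\<close>

section \<open>Resolvents of maximal monotone operators\<close>

lemma graph_of_iff [simp]: "(x, y) \<in> graph_of A \<longleftrightarrow> y \<in> A x"
  by (simp add: graph_of_def)

lemma monotone_operatorD:
  "monotone_operator A \<Longrightarrow> y \<in> A x \<Longrightarrow> y' \<in> A x' \<Longrightarrow> (x - x') \<bullet> (y - y') \<ge> 0"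
  unfolding monotone_operator_def by fastforce

text \<open>Maximality in the form in which it is used: a pair related monotonically to all of the graph could be
  added to it.\<close>
lemma maximal_monotone_absorbs:
  fixes A :: "'a::real_inner \<Rightarrow> 'a set"
  assumes "maximal_monotone A" and rel: "\<And>a b. b \<in> A a \<Longrightarrow> (y - a) \<bullet> (w - b) \<ge> 0"
  shows "w \<in> A y"
proof (rule ccontr)
  assume new: "w \<notin> A y"
  define B where "B = (\<lambda>v. if v = y then insert w (A y) else A v)"
  have in_B: "b \<in> B a \<longleftrightarrow> b \<in> A a \<or> (a = y \<and> b = w)" for a b
    by (auto simp: B_def)
  have mono: "monotone_operator A" and
    max: "\<And>B. monotone_operator B \<Longrightarrow> \<not> graph_of A \<subset> graph_of B"
    using assms(1) by (auto simp: maximal_monotone_def)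
  have rel': "(a - y) \<bullet> (b - w) \<ge> 0" if "b \<in> A a" for a b
    using rel[OF that] by (metis inner_minus_left inner_minus_right minus_diff_eq minus_minus)
  have "(a - a') \<bullet> (b - b') \<ge> 0" if "b \<in> B a" "b' \<in> B a'" for a b a' b'
    using that rel rel' monotone_operatorD[OF mono] unfolding in_B by auto
  then have "monotone_operator B"
    by (auto simp: monotone_operator_def)
  moreover have "graph_of A \<subset> graph_of B"
  proof (rule psubsetI)
    show "graph_of A \<subseteq> graph_of B" by (auto simp: in_B)
    have "(y, w) \<in> graph_of B" "(y, w) \<notin> graph_of A" using new by (auto simp: in_B)
    then show "graph_of A \<noteq> graph_of B" by blast
  qed
  ultimately show False using max by blast
qed

lemma maximal_monotone_nonempty:
  fixes A :: "'a::real_inner \<Rightarrow> 'a set"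
  assumes "maximal_monotone A"
  obtains a b where "b \<in> A a"
  using maximal_monotone_absorbs[OF assms, of 0 0] by fastforce

lemma convex_combination_quadratic:
  fixes v w :: "'a::real_inner"
  shows "(norm ((1 - t) *\<^sub>R v + t *\<^sub>R w))\<^sup>2
    = (1 - t) * (norm v)\<^sup>2 + t * (norm w)\<^sup>2 - t * (1 - t) * (norm (v - w))\<^sup>2"
  unfolding power2_norm_eq_inner by (simp add: algebra_simps inner_commute)

text \<open>Monotonicity says that \<open>s - p \<bullet> b - a \<bullet> q + \<sigma>\<close> is nonnegative for any two of the points
  \<open>(p, q, s)\<close>, \<open>(a, b, \<sigma>)\<close> with \<open>s = p \<bullet> q\<close> and \<open>\<sigma> = a \<bullet> b\<close>. This expression is affine in each
  of the two points, so both may be replaced by points of the convex hull, one after the other; taking them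
  equal gives the claim.\<close>
lemma convex_hull_of_monotone_graph:
  fixes G :: "('a::real_inner \<times> 'a) set"
  assumes mono: "\<And>a b a' b'. (a, b) \<in> G \<Longrightarrow> (a', b') \<in> G \<Longrightarrow> (a - a') \<bullet> (b - b') \<ge> 0"
    and mem: "(p, q, s) \<in> convex hull ((\<lambda>(a, b). (a, b, a \<bullet> b)) ` G)"
  shows "p \<bullet> q \<le> s"
proof -
  let ?S = "(\<lambda>(a, b). (a, b, a \<bullet> b)) ` G"
  have half_space: "convex {(p, q, s). s - p \<bullet> b - a \<bullet> q + \<sigma> \<ge> (0::real)}" for a b :: 'a and \<sigma>
  proof (rule convexI)
    fix c d :: "'a \<times> 'a \<times> real" and k l :: real
    assume cd: "c \<in> {(p, q, s). s - p \<bullet> b - a \<bullet> q + \<sigma> \<ge> 0}" "d \<in> {(p, q, s). s - p \<bullet> b - a \<bullet> q + \<sigma> \<ge> 0}"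
      and kl: "0 \<le> k" "0 \<le> l" "k + l = 1"
    obtain p q s p' q' s' where c: "c = (p, q, s)" and d: "d = (p', q', s')"
      using prod_cases3 by metis
    have h: "0 \<le> s - p \<bullet> b - a \<bullet> q + \<sigma>" "0 \<le> s' - p' \<bullet> b - a \<bullet> q' + \<sigma>"
      using cd by (auto simp: c d)
    have "0 \<le> k * (s - p \<bullet> b - a \<bullet> q + \<sigma>) + l * (s' - p' \<bullet> b - a \<bullet> q' + \<sigma>)"
      using h kl by simp
    also have "\<dots> = k * s + l * s' - (k *\<^sub>R p + l *\<^sub>R p') \<bullet> b - a \<bullet> (k *\<^sub>R q + l *\<^sub>R q') + (k + l) * \<sigma>"
      by (simp add: algebra_simps)
    finally show "k *\<^sub>R c + l *\<^sub>R d \<in> {(p, q, s). s - p \<bullet> b - a \<bullet> q + \<sigma> \<ge> 0}"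
      using kl by (simp add: c d)
  qed
  have vertex: "s' - p' \<bullet> b - a \<bullet> q' + a \<bullet> b \<ge> 0"
    if "(a, b) \<in> G" "(p', q', s') \<in> convex hull ?S" for a b p' q' s'
  proof -
    have "convex hull ?S \<subseteq> {(p, q, s). s - p \<bullet> b - a \<bullet> q + a \<bullet> b \<ge> 0}"
    proof (intro hull_minimal half_space, clarify)
      fix a' b' assume "(a', b') \<in> G"
      from mono[OF this that(1)] show "0 \<le> a' \<bullet> b' - a' \<bullet> b - a \<bullet> b' + a \<bullet> b"
        by (simp add: algebra_simps)
    qed
    then show ?thesis using that(2) by auto
  qed
  have "convex hull ?S \<subseteq> {(a, b, \<sigma>). \<sigma> - a \<bullet> q - p \<bullet> b + s \<ge> 0}"
    using vertex[OF _ mem]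
    by (intro hull_minimal half_space) (auto simp: algebra_simps)
  then show ?thesis using mem by (auto simp: inner_commute)
qed

text \<open>The analytic core of Minty's theorem, for the resolvent at \<open>0\<close>. With \<open>Q\<close> the quadratic
  \<open>\<parallel>a - b\<parallel>\<^sup>2 / 4 + s\<close> on the convex hull, the quantity to be bounded is
  \<open>\<parallel>v\<^sub>0 - (a - b)\<parallel>\<^sup>2 / 4 - Q (a, b, a \<bullet> b)\<close> for \<open>y = v\<^sub>0 / 2\<close>, which the first order condition for the
  infimum \<open>m\<close> of \<open>Q\<close> bounds by \<open>- m\<close>. Since \<open>s \<ge> a \<bullet> b\<close> on the hull, \<open>Q \<ge> \<parallel>a + b\<parallel>\<^sup>2 / 4\<close>
  there, so \<open>m \<ge> 0\<close>.\<close>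
lemma minty_for_monotone_sets:
  fixes G :: "('a::{real_inner, complete_space} \<times> 'a) set"
  assumes mono: "\<And>a b a' b'. (a, b) \<in> G \<Longrightarrow> (a', b') \<in> G \<Longrightarrow> (a - a') \<bullet> (b - b') \<ge> 0"
    and "G \<noteq> {}"
  shows "\<exists>y. \<forall>(a, b) \<in> G. (y - a) \<bullet> (y + b) \<le> 0"
proof -
  define C where "C = convex hull ((\<lambda>(a, b). (a, b, a \<bullet> b)) ` G)"
  define v where "v = (\<lambda>c :: 'a \<times> 'a \<times> real. fst c - fst (snd c))"
  define Q where "Q = (\<lambda>c :: 'a \<times> 'a \<times> real. (norm (v c))\<^sup>2 / 4 + snd (snd c))"
  have Q_nonneg: "Q c \<ge> 0" if "c \<in> C" for c
  proof -
    obtain a b s where c: "c = (a, b, s)" using prod_cases3 by blast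
    have "a \<bullet> b \<le> s"
      using convex_hull_of_monotone_graph[OF mono] that unfolding c C_def by blast
    then have "Q c \<ge> (norm (a - b))\<^sup>2 / 4 + a \<bullet> b" by (simp add: Q_def v_def c)
    moreover have "(norm (a - b))\<^sup>2 / 4 + a \<bullet> b = (norm (a + b))\<^sup>2 / 4"
      unfolding power2_norm_eq_inner by (simp add: field_simps inner_simps inner_commute)
    ultimately show ?thesis by (smt (verit) zero_le_power2 divide_nonneg_pos)
  qed
  have C_ne: "C \<noteq> {}" using assms(2) by (simp add: C_def)
  have bdd: "bdd_below (Q ` C)" using Q_nonneg by (auto intro!: bdd_belowI)
  define m where "m = (INF c\<in>C. Q c)"
  have m_le: "m \<le> Q c" if "c \<in> C" for c
    unfolding m_def using bdd that by (rule cINF_lower)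
  have m_nonneg: "m \<ge> 0" unfolding m_def using C_ne Q_nonneg by (intro cINF_greatest) auto
  have Q_comb: "Q ((1 - t) *\<^sub>R c + t *\<^sub>R d)
      = (1 - t) * Q c + t * Q d - t * (1 - t) * (norm (v c - v d))\<^sup>2 / 4" for t c d
  proof -
    have lin: "v ((1 - t) *\<^sub>R c + t *\<^sub>R d) = (1 - t) *\<^sub>R v c + t *\<^sub>R v d"
      by (simp add: v_def algebra_simps)
    show ?thesis unfolding Q_def lin convex_combination_quadratic by (simp add: field_simps)
  qed
  have comb_in: "(1 - t) *\<^sub>R c + t *\<^sub>R d \<in> C" if "c \<in> C" "d \<in> C" "0 \<le> t" "t \<le> 1" for t c d
    using that convex_convex_hull unfolding C_def by (intro convexD) auto
  have "\<exists>c\<in>C. Q c < m + 1 / real (Suc n)" for n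
    using cINF_less_iff[OF C_ne bdd, of "m + 1 / real (Suc n)"] by (simp add: m_def)
  then obtain c where c_in: "\<And>n. c n \<in> C" and c_small: "\<And>n. Q (c n) < m + 1 / real (Suc n)"
    by metis
  have Q_lim: "(\<lambda>n. Q (c n)) \<longlonglongrightarrow> m"
  proof (rule tendsto_sandwich[of "\<lambda>_. m" _ _ "\<lambda>n. m + 1 / real (Suc n)"])
    show "(\<lambda>n. m + 1 / real (Suc n)) \<longlonglongrightarrow> m"
      using tendsto_add[OF tendsto_const LIMSEQ_inverse_real_of_nat, of m]
      by (simp add: inverse_eq_divide)
    show "\<forall>\<^sub>F n in sequentially. Q (c n) \<le> m + 1 / real (Suc n)"
      using c_small by (intro always_eventually allI less_imp_le)
  qed (simp_all add: c_in m_le)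
  \<comment> \<open>The parallelogram identity at the midpoint, where \<open>Q\<close> is still at least \<open>m\<close>.\<close>
  have Cauchy_aux: "(norm (v (c i) - v (c j)))\<^sup>2 \<le> 8 * (Q (c i) - m) + 8 * (Q (c j) - m)" for i j
    using m_le[OF comb_in[OF c_in c_in], of "1/2" i j] unfolding Q_comb by simp
  have "Cauchy (\<lambda>n. v (c n))"
  proof (rule CauchyI)
    fix e :: real assume "e > 0"
    then have "\<forall>\<^sub>F n in sequentially. Q (c n) < m + e\<^sup>2 / 16"
      by (intro order_tendstoD(2)[OF Q_lim]) simp
    then obtain M where M: "\<And>n. n \<ge> M \<Longrightarrow> Q (c n) < m + e\<^sup>2 / 16"
      by (auto simp: eventually_sequentially)
    have "norm (v (c i) - v (c j)) < e" if "i \<ge> M" "j \<ge> M" for i j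
    proof -
      have "(norm (v (c i) - v (c j)))\<^sup>2 < e\<^sup>2"
        using Cauchy_aux[of i j] M[OF that(1)] M[OF that(2)] by (simp add: field_simps)
      then show ?thesis using \<open>e > 0\<close> by (simp add: power_less_imp_less_base)
    qed
    then show "\<exists>M. \<forall>i\<ge>M. \<forall>j\<ge>M. norm (v (c i) - v (c j)) < e" by blast
  qed
  then obtain v\<^sub>0 where v_lim: "(\<lambda>n. v (c n)) \<longlonglongrightarrow> v\<^sub>0"
    using Cauchy_convergent convergent_def by blast
  \<comment> \<open>Move from \<open>c n\<close> a fraction \<open>t\<close> towards \<open>d\<close>, let \<open>n\<close> tend to infinity, divide by \<open>t\<close>, and let
    \<open>t\<close> tend to \<open>0\<close>. The infimum of \<open>Q\<close> itself need not be attained.\<close>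
  have first_order: "(norm (v\<^sub>0 - v d))\<^sup>2 / 4 \<le> Q d - m" if "d \<in> C" for d
  proof -
    have bound: "(1 - t) * (norm (v\<^sub>0 - v d))\<^sup>2 / 4 \<le> Q d - m" if t: "0 < t" "t \<le> 1" for t
    proof -
      have "(\<lambda>n. (1 - t) * Q (c n) + t * Q d - t * (1 - t) * (norm (v (c n) - v d))\<^sup>2 / 4)
          \<longlonglongrightarrow> (1 - t) * m + t * Q d - t * (1 - t) * (norm (v\<^sub>0 - v d))\<^sup>2 / 4"
        by (intro tendsto_intros Q_lim v_lim) simp_all
      moreover have "m \<le> (1 - t) * Q (c n) + t * Q d - t * (1 - t) * (norm (v (c n) - v d))\<^sup>2 / 4" for n
        using m_le[OF comb_in[OF c_in \<open>d \<in> C\<close>]] t unfolding Q_comb by simp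
      ultimately have "m \<le> (1 - t) * m + t * Q d - t * (1 - t) * (norm (v\<^sub>0 - v d))\<^sup>2 / 4"
        by (intro LIMSEQ_le_const) auto
      then have "t * ((1 - t) * (norm (v\<^sub>0 - v d))\<^sup>2 / 4) \<le> t * (Q d - m)"
        by (simp add: algebra_simps)
      then show ?thesis using t by simp
    qed
    have "(\<lambda>n. (1 - 1 / real (Suc n)) * (norm (v\<^sub>0 - v d))\<^sup>2 / 4) \<longlonglongrightarrow> (1 - 0) * (norm (v\<^sub>0 - v d))\<^sup>2 / 4"
      using LIMSEQ_inverse_real_of_nat by (intro tendsto_intros) (simp_all add: inverse_eq_divide)
    moreover have "(1 - 1 / real (Suc n)) * (norm (v\<^sub>0 - v d))\<^sup>2 / 4 \<le> Q d - m" for n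
      by (rule bound) simp_all
    ultimately have "(1 - 0) * (norm (v\<^sub>0 - v d))\<^sup>2 / 4 \<le> Q d - m"
      by (rule LIMSEQ_le_const2[OF _ exI, OF _ allI, OF _ impI])
    then show ?thesis by simp
  qed
  have "((1/2) *\<^sub>R v\<^sub>0 - a) \<bullet> ((1/2) *\<^sub>R v\<^sub>0 + b) \<le> 0" if "(a, b) \<in> G" for a b
  proof -
    have "(a, b, a \<bullet> b) \<in> C" using that by (auto simp: C_def intro!: hull_inc)
    note first_order[OF this]
    moreover have "((1/2) *\<^sub>R v\<^sub>0 - a) \<bullet> ((1/2) *\<^sub>R v\<^sub>0 + b)
        = (norm (v\<^sub>0 - v (a, b, a \<bullet> b)))\<^sup>2 / 4 - Q (a, b, a \<bullet> b)"
      unfolding Q_def v_def power2_norm_eq_inner by (simp add: field_simps inner_simps inner_commute)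
    ultimately show ?thesis using m_nonneg by linarith
  qed
  then show ?thesis by blast
qed

lemma monotone_scale_op:
  assumes "monotone_operator A" "c > 0"
  shows "monotone_operator (scale_op c A)"
  using monotone_operatorD[OF assms(1)] assms(2)
  by (auto simp: monotone_operator_def scale_op_def simp flip: scaleR_diff_right)

lemma maximal_monotone_scale_op_absorbs:
  fixes A :: "'a::real_inner \<Rightarrow> 'a set"
  assumes "maximal_monotone A" "c > 0"
    and rel: "\<And>a b. b \<in> scale_op c A a \<Longrightarrow> (y - a) \<bullet> (w - b) \<ge> 0"
  shows "w \<in> scale_op c A y"
proof -
  have "(1 / c) *\<^sub>R w \<in> A y"
  proof (rule maximal_monotone_absorbs[OF assms(1)])
    fix a b assume "b \<in> A a"
    then have "(y - a) \<bullet> (w - c *\<^sub>R b) \<ge> 0" by (intro rel) (auto simp: scale_op_def)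
    then have "(1 / c) * ((y - a) \<bullet> (w - c *\<^sub>R b)) \<ge> 0" using assms(2) by simp
    also have "(1 / c) * ((y - a) \<bullet> (w - c *\<^sub>R b)) = (y - a) \<bullet> ((1 / c) *\<^sub>R (w - c *\<^sub>R b))" by simp
    also have "(1 / c) *\<^sub>R (w - c *\<^sub>R b) = (1 / c) *\<^sub>R w - b"
      using assms(2) by (simp add: scaleR_diff_right)
    finally show "(y - a) \<bullet> ((1 / c) *\<^sub>R w - b) \<ge> 0" .
  qed
  moreover have "w = c *\<^sub>R ((1 / c) *\<^sub>R w)" using assms(2) by simp
  ultimately show ?thesis unfolding scale_op_def by blast
qed

locale scaled_maximal_monotone =
  fixes U :: "'a::{real_inner, complete_space} \<Rightarrow> 'a set" and c :: real
  assumes maximal: "maximal_monotone U" and c_pos: "c > 0"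
begin

abbreviation J where "J \<equiv> resolvent (scale_op c U)"
abbreviation R where "R \<equiv> reflected_resolvent (scale_op c U)"

lemma monotone: "monotone_operator (scale_op c U)"
  using maximal c_pos by (simp add: maximal_monotone_def monotone_scale_op)

text \<open>Minty's theorem: translating the graph by \<open>x\<close> in the second component reduces the resolvent at \<open>x\<close>
  to the one at \<open>0\<close>.\<close>
lemma resolvent_mem: "x - J x \<in> scale_op c U (J x)"
proof -
  define G where "G = {(a, b - x) |a b. b \<in> scale_op c U a}"
  have "(a - a') \<bullet> (b - b') \<ge> 0" if "(a, b) \<in> G" "(a', b') \<in> G" for a b a' b'
  proof -
    have "b + x \<in> scale_op c U a" "b' + x \<in> scale_op c U a'"
      using that by (auto simp: G_def)
    from monotone_operatorD[OF monotone this] show ?thesis by simp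
  qed
  moreover have "G \<noteq> {}"
  proof -
    obtain a b where "b \<in> U a" using maximal_monotone_nonempty[OF maximal] .
    then have "(a, c *\<^sub>R b - x) \<in> G" by (auto simp: G_def scale_op_def)
    then show ?thesis by blast
  qed
  ultimately obtain y where y: "\<forall>(a, b) \<in> G. (y - a) \<bullet> (y + b) \<le> 0"
    using minty_for_monotone_sets[of G] by blast
  have "(y - a) \<bullet> ((x - y) - b) \<ge> 0" if "b \<in> scale_op c U a" for a b
  proof -
    have "(y - a) \<bullet> (y + (b - x)) \<le> 0" using that y by (auto simp: G_def)
    moreover have "(y - a) \<bullet> ((x - y) - b) = - ((y - a) \<bullet> (y + (b - x)))"
      by (simp add: algebra_simps)
    ultimately show ?thesis by simp
  qed
  then have ex: "x - y \<in> scale_op c U y"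
    by (rule maximal_monotone_scale_op_absorbs[OF maximal c_pos])
  have iff: "x \<in> {y} + scale_op c U y \<longleftrightarrow> x - y \<in> scale_op c U y" for y
  proof
    show "x \<in> {y} + scale_op c U y" if "x - y \<in> scale_op c U y"
      using set_plus_intro[of y "{y}", OF _ that] by simp
    show "x - y \<in> scale_op c U y" if x: "x \<in> {y} + scale_op c U y"
    proof -
      obtain b where "b \<in> scale_op c U y" "x = y + b"
        using x by (blast elim: set_plus_elim)
      then show ?thesis by simp
    qed
  qed
  have "y' = y" if "x - y' \<in> scale_op c U y'" for y'
  proof -
    have "0 \<le> (y' - y) \<bullet> ((x - y') - (x - y))" by (rule monotone_operatorD[OF monotone that ex])
    also have "(y' - y) \<bullet> ((x - y') - (x - y)) = - ((y' - y) \<bullet> (y' - y))"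
      by (simp add: algebra_simps)
    finally have "(y' - y) \<bullet> (y' - y) = 0" using inner_ge_zero[of "y' - y"] by linarith
    then show ?thesis by simp
  qed
  then have "J x = y" unfolding resolvent_def iff using ex by blast
  then show ?thesis using ex by simp
qed

lemma firmly_nonexpansive: "(J x - J x') \<bullet> ((x - x') - (J x - J x')) \<ge> 0"
  using monotone_operatorD[OF monotone resolvent_mem resolvent_mem, of x x']
  by (simp add: algebra_simps)

lemma R_nonexpansive: "norm (R x - R x') \<le> norm (x - x')"
proof -
  have "(norm (R x - R x'))\<^sup>2
      = (norm (x - x'))\<^sup>2 - 4 * ((J x - J x') \<bullet> ((x - x') - (J x - J x')))"
    by (simp add: reflected_resolvent_def power2_norm_eq_inner algebra_simps inner_commute)
  then have "(norm (R x - R x'))\<^sup>2 \<le> (norm (x - x'))\<^sup>2"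
    using firmly_nonexpansive[of x x'] by simp
  then show ?thesis by (rule power2_le_imp_le) simp
qed

lemma J_nonexpansive: "norm (J x - J x') \<le> norm (x - x')"
proof -
  have "norm (2 *\<^sub>R (J x - J x')) = norm ((R x - R x') + (x - x'))"
    by (simp add: reflected_resolvent_def algebra_simps)
  also have "\<dots> \<le> 2 * norm (x - x')"
    using norm_triangle_ineq[of "R x - R x'" "x - x'"] R_nonexpansive[of x x'] by simp
  finally show ?thesis by simp
qed

end

section \<open>Nonexpansive maps and their fixed points\<close>

text \<open>The image of a point \<open>m\<close> of the segment has almost the same distances to both endpoints as \<open>m\<close>
  has, and these determine a point of the segment in a strictly convex space. For \<open>\<eta> = 0\<close> this is the convexity of
  the fixed point set.\<close>
lemma nonexpansive_approx_fixed_segment: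
  fixes T :: "'a::real_inner \<Rightarrow> 'a"
  assumes nonexpansive: "\<And>v w. norm (T v - T w) \<le> norm (v - w)"
    and v: "norm (T v - v) \<le> \<eta>" and w: "norm (T w - w) \<le> \<eta>" and t: "0 \<le> t" "t \<le> 1"
  defines "m \<equiv> (1 - t) *\<^sub>R v + t *\<^sub>R w"
  shows "(norm (T m - m))\<^sup>2 \<le> \<eta> * norm (v - w) + \<eta>\<^sup>2"
proof -
  define d where "d = norm (v - w)"
  have \<eta>: "\<eta> \<ge> 0" using v norm_ge_zero order_trans by blast
  have d: "d \<ge> 0" by (simp add: d_def)
  have "m - v = t *\<^sub>R (w - v)" "m - w = (1 - t) *\<^sub>R (v - w)"
    by (simp_all add: m_def algebra_simps)
  then have m_dist: "norm (m - v) = t * d" "norm (m - w) = (1 - t) * d"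
    using t by (simp_all add: d_def norm_minus_commute)
  have Tm_v: "norm (T m - v) \<le> t * d + \<eta>"
    using norm_triangle_ineq[of "T m - T v" "T v - v"] nonexpansive[of m v] v m_dist by simp
  have Tm_w: "norm (T m - w) \<le> (1 - t) * d + \<eta>"
    using norm_triangle_ineq[of "T m - T w" "T w - w"] nonexpansive[of m w] w m_dist by simp
  have "T m - m = (1 - t) *\<^sub>R (T m - v) + t *\<^sub>R (T m - w)"
    by (simp add: m_def algebra_simps)
  then have "(norm (T m - m))\<^sup>2
      = (1 - t) * (norm (T m - v))\<^sup>2 + t * (norm (T m - w))\<^sup>2 - t * (1 - t) * d\<^sup>2"
    using convex_combination_quadratic[of t "T m - v" "T m - w"]
    by (simp add: d_def norm_minus_commute)
  also have "\<dots> \<le> (1 - t) * (t * d + \<eta>)\<^sup>2 + t * ((1 - t) * d + \<eta>)\<^sup>2 - t * (1 - t) * d\<^sup>2"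
    using Tm_v Tm_w t by (intro diff_right_mono add_mono mult_left_mono power_mono) auto
  also have "\<dots> = (4 * t * (1 - t)) * (\<eta> * d) + \<eta>\<^sup>2"
    by (simp add: power2_eq_square algebra_simps)
  also have "\<dots> \<le> 1 * (\<eta> * d) + \<eta>\<^sup>2"
  proof -
    have "4 * t * (1 - t) \<le> 1" using zero_le_power2[of "2 * t - 1"]
      by (simp add: power2_eq_square algebra_simps)
    then show ?thesis using \<eta> d by (intro add_right_mono mult_right_mono) auto
  qed
  finally show ?thesis by (simp add: d_def)
qed

text \<open>Uniqueness of the nearest point: the midpoint of two nearest points is a fixed point as well, and it is
  strictly nearer to \<open>u\<close> unless they coincide.\<close>
lemma metric_projection_Fix_eqI:
  fixes T :: "'a::real_inner \<Rightarrow> 'a"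
  assumes nonexpansive: "\<And>v w. norm (T v - T w) \<le> norm (v - w)"
    and q: "q \<in> Fix T" and min: "\<And>r. r \<in> Fix T \<Longrightarrow> norm (u - q) \<le> norm (u - r)"
  shows "metric_projection (Fix T) u = q"
  unfolding metric_projection_def
proof (rule the_equality)
  show "q \<in> Fix T \<and> (\<forall>z\<in>Fix T. dist u q \<le> dist u z)"
    using q min by (simp add: dist_norm)
next
  fix q' assume q': "q' \<in> Fix T \<and> (\<forall>z\<in>Fix T. dist u q' \<le> dist u z)"
  define m where "m = (1 - 1/2) *\<^sub>R q + (1/2) *\<^sub>R q'"
  have "(norm (T m - m))\<^sup>2 \<le> 0 * norm (q - q') + 0\<^sup>2"
    unfolding m_def using q q' nonexpansive
    by (intro nonexpansive_approx_fixed_segment) (auto simp: Fix_def)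
  then have m: "m \<in> Fix T" by (simp add: Fix_def)
  have eq: "norm (u - q') = norm (u - q)"
    using q' q min[of q'] by (auto simp: dist_norm intro: antisym)
  have "u - m = (1 - 1/2) *\<^sub>R (u - q) + (1/2) *\<^sub>R (u - q')"
  proof -
    have "u = (1/2) *\<^sub>R u + (1/2) *\<^sub>R u" by (simp flip: scaleR_add_left)
    then show ?thesis by (simp add: m_def algebra_simps)
  qed
  moreover have "norm (u - q - (u - q')) = norm (q - q')"
    by (simp add: norm_minus_commute)
  ultimately have "(norm (u - m))\<^sup>2 = (norm (u - q))\<^sup>2 - (norm (q - q'))\<^sup>2 / 4"
    using convex_combination_quadratic[of "1/2" "u - q" "u - q'"] by (simp only: eq) simp
  moreover have "(norm (u - q))\<^sup>2 \<le> (norm (u - m))\<^sup>2"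
    using min[OF m] by (intro power_mono) auto
  ultimately have "(norm (q - q'))\<^sup>2 \<le> 0" by simp
  then show "q' = q" by simp
qed

lemma tendsto_nonexpansive:
  fixes g :: "'a::real_normed_vector \<Rightarrow> 'b::real_normed_vector"
  assumes "\<And>v w. norm (g v - g w) \<le> norm (v - w)" "w \<longlonglongrightarrow> q"
  shows "(\<lambda>n. g (w n)) \<longlonglongrightarrow> g q"
proof (rule LIMSEQ_I)
  fix r :: real assume "r > 0"
  then obtain M where "\<And>n. n \<ge> M \<Longrightarrow> norm (w n - q) < r"
    using LIMSEQ_D[OF assms(2)] by blast
  then have "norm (g (w n) - g q) < r" if "n \<ge> M" for n
    using le_less_trans[OF assms(1)] that by blast
  then show "\<exists>M. \<forall>n\<ge>M. norm (g (w n) - g q) < r" by blast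
qed

section \<open>Real recurrences\<close>

text \<open>With \<open>P\<close> the product of the factors \<open>1 - a k\<close>, induction gives the sharper bound in which \<open>s 0\<close>
  and \<open>B\<close> have the weights \<open>P\<close> and \<open>1 - P\<close>; then \<open>P\<close> is estimated by the exponential.\<close>
lemma contracting_recurrence_bound:
  fixes s a c :: "nat \<Rightarrow> real"
  assumes step: "\<And>k. k < n \<Longrightarrow> s (Suc k) \<le> (1 - a k) * s k + a k * B + c k"
    and a: "\<And>k. 0 \<le> a k" "\<And>k. a k \<le> 1" and c: "\<And>k. 0 \<le> c k" and nonneg: "0 \<le> B" "0 \<le> s 0"
  shows "s n \<le> exp (- (\<Sum>k<n. a k)) * s 0 + B + (\<Sum>k<n. c k)"
proof -
  let ?P = "\<lambda>n. \<Prod>k<n. 1 - a k"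
  have "s n \<le> ?P n * s 0 + (1 - ?P n) * B + (\<Sum>k<n. c k)" using step
  proof (induction n)
    case (Suc n)
    have C: "0 \<le> (\<Sum>k<n. c k)" using c by (intro sum_nonneg) auto
    have "s (Suc n) \<le> (1 - a n) * s n + a n * B + c n" by (rule Suc.prems) simp
    also have "\<dots> \<le> (1 - a n) * (?P n * s 0 + (1 - ?P n) * B + (\<Sum>k<n. c k)) + a n * B + c n"
      using Suc a[of n] by (intro add_right_mono mult_left_mono) auto
    also have "\<dots> = ?P (Suc n) * s 0 + (1 - ?P (Suc n)) * B + (1 - a n) * (\<Sum>k<n. c k) + c n"
      by (simp add: algebra_simps)
    also have "\<dots> \<le> ?P (Suc n) * s 0 + (1 - ?P (Suc n)) * B + 1 * (\<Sum>k<n. c k) + c n"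
      using C a[of n] by (intro add_mono order_refl mult_right_mono) auto
    finally show ?case by simp
  qed simp
  moreover have "?P n \<le> exp (- (\<Sum>k<n. a k))"
  proof -
    have "?P n \<le> (\<Prod>k<n. exp (- a k))"
      using a exp_ge_add_one_self[of "- a _"] by (intro prod_mono) auto
    also have "\<dots> = exp (- (\<Sum>k<n. a k))" by (simp only: sum_negf[symmetric] exp_sum finite_lessThan)
    finally show ?thesis .
  qed
  moreover have "0 \<le> ?P n" using a by (intro prod_nonneg) auto
  ultimately show ?thesis
    using nonneg mult_right_mono[of "?P n" "exp (- (\<Sum>k<n. a k))" "s 0"]
      mult_right_mono[of "1 - ?P n" 1 B] by simp
qed

lemma sum_shift_lessThan:
  fixes g :: "nat \<Rightarrow> real"
  shows "(\<Sum>k<m. g (K + k)) = (\<Sum>i=K..<K + m. g i)"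
  by (induction m) (auto simp: add.assoc)

lemma sum_tail_le:
  fixes g :: "nat \<Rightarrow> real"
  assumes "\<And>i. 0 \<le> g i" and bound: "\<And>n. (\<Sum>i=G + 1..G + n. g i) \<le> e" and "G \<le> K"
  shows "(\<Sum>k<m. g (K + 1 + k)) \<le> e"
proof -
  have "(\<Sum>k<m. g (K + 1 + k)) = (\<Sum>i=K + 1..<K + 1 + m. g i)"
    by (rule sum_shift_lessThan)
  also have "\<dots> \<le> (\<Sum>i=G + 1..G + (K + m). g i)"
    using assms(1,3) by (intro sum_mono2) auto
  also have "\<dots> \<le> e" by (rule bound)
  finally show ?thesis .
qed

text \<open>Dropping the first \<open>K\<close> terms costs at most \<open>K\<close>, since each term is at most \<open>1\<close>.\<close>
lemma sum_ge_of_rate_of_divergence: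
  fixes \<alpha> :: "nat \<Rightarrow> real"
  assumes \<alpha>: "\<And>n. 0 \<le> \<alpha> n" "\<And>n. \<alpha> n \<le> 1"
    and rate: "(\<Sum>i = 0..\<Gamma>. \<alpha> i) \<ge> real (K + L)" and m: "\<Gamma> + 1 \<le> K + m"
  shows "real L \<le> (\<Sum>k<m. \<alpha> (K + k))"
proof -
  have "real (K + L) \<le> (\<Sum>i = 0..\<Gamma>. \<alpha> i)" by (rule rate)
  also have "\<dots> \<le> (\<Sum>i\<in>{..<K} \<union> {K..<K + m}. \<alpha> i)"
    using m \<alpha> by (intro sum_mono2) auto
  also have "\<dots> = (\<Sum>i<K. \<alpha> i) + (\<Sum>i=K..<K + m. \<alpha> i)"
    by (rule sum.union_disjoint) auto
  also have "(\<Sum>i<K. \<alpha> i) \<le> real K"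
    using sum_bounded_above[of "{..<K}" \<alpha> 1] \<alpha> by simp
  finally show ?thesis by (simp add: sum_shift_lessThan)
qed

section \<open>Rates of metastability\<close>

text \<open>If \<open>w\<close> is not Cauchy, let \<open>f n\<close> be an index below which a gap of size \<open>e\<close> occurs after \<open>n\<close>.\<close>
lemma rate_of_metastability_imp_Cauchy:
  assumes "rate_of_metastability M w"
  shows "Cauchy w"
proof (rule ccontr)
  assume "\<not> Cauchy w"
  then obtain e where e: "e > 0" and "\<And>n. \<exists>i\<ge>n. \<exists>j\<ge>n. \<not> norm (w i - w j) < e"
    unfolding Cauchy_iff by meson
  then obtain i j where ij: "\<And>n. i n \<ge> n" "\<And>n. j n \<ge> n" "\<And>n. \<not> norm (w (i n) - w (j n)) < e"
    by metis
  obtain n where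
    "\<forall>k\<in>{n..max (i n) (j n)}. \<forall>l\<in>{n..max (i n) (j n)}. norm (w k - w l) \<le> e / 2"
    using assms[unfolded rate_of_metastability_def, rule_format, of "e / 2" "\<lambda>n. max (i n) (j n)"] e
    by auto
  then have "norm (w (i n) - w (j n)) \<le> e / 2" using ij by simp
  then show False using e ij(3)[of n] by simp
qed

lemma rate_of_metastability_nonexpansive_odd:
  fixes x :: "nat \<Rightarrow> 'a::real_normed_vector"
  assumes M: "rate_of_metastability M x"
    and le: "\<And>i j. norm (v i - v j) \<le> norm (x (2 * i + 1) - x (2 * j + 1))"
  shows "rate_of_metastability (\<lambda>\<epsilon> f. M \<epsilon> (\<lambda>n. 2 * f n + 1)) v"
  unfolding rate_of_metastability_def
proof (intro allI impI)
  fix \<epsilon> :: real and f :: "nat \<Rightarrow> nat" assume "\<epsilon> > 0"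
  then obtain n where n: "n \<le> M \<epsilon> (\<lambda>n. 2 * f n + 1)"
    and meta: "\<And>i j. i \<in> {n..2 * f n + 1} \<Longrightarrow> j \<in> {n..2 * f n + 1} \<Longrightarrow> norm (x i - x j) \<le> \<epsilon>"
    using M[unfolded rate_of_metastability_def, rule_format, of \<epsilon> "\<lambda>n. 2 * f n + 1"] by blast
  have "norm (v i - v j) \<le> \<epsilon>" if "i \<in> {n..f n}" "j \<in> {n..f n}" for i j
    by (rule order_trans[OF le meta]) (use that in auto)
  then show "\<exists>n\<le>M \<epsilon> (\<lambda>n. 2 * f n + 1). \<forall>i\<in>{n..f n}. \<forall>j\<in>{n..f n}. norm (v i - v j) \<le> \<epsilon>"
    using n by blast
qed

lemma rate_of_metastability_smaller_precision:
  assumes "rate_of_metastability M w" "k \<ge> 1"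
  shows "rate_of_metastability (\<lambda>\<epsilon>. M (\<epsilon> / k)) w"
  unfolding rate_of_metastability_def
proof (intro allI impI)
  fix \<epsilon> :: real and f :: "nat \<Rightarrow> nat" assume \<epsilon>: "\<epsilon> > 0"
  have "\<epsilon> / k > 0" "\<epsilon> / k \<le> \<epsilon>" using \<epsilon> assms(2) by (simp_all add: divide_le_eq)
  then obtain n where "n \<le> M (\<epsilon> / k) f"
    and "\<And>i j. i \<in> {n..f n} \<Longrightarrow> j \<in> {n..f n} \<Longrightarrow> norm (w i - w j) \<le> \<epsilon> / k"
    using assms(1)[unfolded rate_of_metastability_def, rule_format, of "\<epsilon> / k" f] by blast
  then show "\<exists>n\<le>M (\<epsilon> / k) f. \<forall>i\<in>{n..f n}. \<forall>j\<in>{n..f n}. norm (w i - w j) \<le> \<epsilon>"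
    using \<open>\<epsilon> / k \<le> \<epsilon>\<close> by (intro exI[of _ n] conjI ballI) (auto intro: order_trans)
qed

section \<open>The Halpern--Mann iteration\<close>

text \<open>Here \<open>b\<close> is the weight of the identity in the Mann step and \<open>\<gamma>\<close> its distance from \<open>0\<close> and \<open>1\<close>. The ball
  of radius \<open>N\<close> around the fixed point \<open>p\<close> contains the whole sequence, and all quantitative statements about
  approximate fixed points refer to it.\<close>
locale halpern_mann =
  fixes T :: "'a::real_inner \<Rightarrow> 'a" and p u :: 'a
    and N :: nat and \<gamma> :: real and \<alpha> b :: "nat \<Rightarrow> real" and x :: "nat \<Rightarrow> 'a"
    and \<Gamma>\<^sub>1 :: "real \<Rightarrow> nat" and \<Gamma>\<^sub>2 :: "nat \<Rightarrow> nat" and \<Gamma>\<^sub>3 \<Gamma>\<^sub>4 :: "real \<Rightarrow> nat"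
  assumes nonexpansive: "norm (T v - T w) \<le> norm (v - w)"
    and fixed: "T p = p"
    and N_pos: "N > 0" and x_0: "norm (x 0 - p) \<le> N" and u_bound: "2 * norm (u - p) \<le> N"
    and \<gamma>_pos: "\<gamma> > 0"
    and \<alpha>_nonneg: "0 \<le> \<alpha> n" and \<alpha>_le: "\<alpha> n \<le> 1"
    and b_ge: "\<gamma> \<le> b n" and b_le: "b n \<le> 1 - \<gamma>"
    and halpern_step: "x (2 * n + 1) = (1 - \<alpha> n) *\<^sub>R x (2 * n) + \<alpha> n *\<^sub>R u"
    and mann_step: "x (2 * n + 2) = (1 - b n) *\<^sub>R T (x (2 * n + 1)) + b n *\<^sub>R x (2 * n + 1)"
    and \<Gamma>\<^sub>1_anti: "antimono_on {0<..} \<Gamma>\<^sub>1" and \<Gamma>\<^sub>2_mono: "mono \<Gamma>\<^sub>2"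
    and \<Gamma>\<^sub>3_anti: "antimono_on {0<..} \<Gamma>\<^sub>3" and \<Gamma>\<^sub>4_anti: "antimono_on {0<..} \<Gamma>\<^sub>4"
    and rate_\<alpha>: "\<epsilon> > 0 \<Longrightarrow> n \<ge> \<Gamma>\<^sub>1 \<epsilon> \<Longrightarrow> \<alpha> n \<le> \<epsilon>"
    and rate_sum_\<alpha>: "(\<Sum>i = 0..\<Gamma>\<^sub>2 k. \<alpha> i) \<ge> real k"
    and rate_var_\<alpha>: "\<epsilon> > 0 \<Longrightarrow> (\<Sum>i = \<Gamma>\<^sub>3 \<epsilon> + 1..\<Gamma>\<^sub>3 \<epsilon> + n. \<bar>\<alpha> (i + 1) - \<alpha> i\<bar>) \<le> \<epsilon>"
    and rate_var_b: "\<epsilon> > 0 \<Longrightarrow> (\<Sum>i = \<Gamma>\<^sub>4 \<epsilon> + 1..\<Gamma>\<^sub>4 \<epsilon> + n. \<bar>b (i + 1) - b i\<bar>) \<le> \<epsilon>"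
begin

abbreviation "V \<equiv> mu_V N \<Gamma>\<^sub>3 \<Gamma>\<^sub>4"
abbreviation "\<theta>\<^sub>1 \<equiv> mu_theta1 N \<Gamma>\<^sub>2 \<Gamma>\<^sub>3 \<Gamma>\<^sub>4"
abbreviation "\<theta>\<^sub>3 \<equiv> mu_theta3 N \<gamma> \<Gamma>\<^sub>1 \<Gamma>\<^sub>2 \<Gamma>\<^sub>3 \<Gamma>\<^sub>4"
abbreviation "\<theta>\<^sub>4 \<equiv> mu_theta4 N \<gamma> \<Gamma>\<^sub>1 \<Gamma>\<^sub>2 \<Gamma>\<^sub>3 \<Gamma>\<^sub>4"
abbreviation "\<rho>\<^sub>2 \<equiv> mu_rho2 N \<gamma> \<Gamma>\<^sub>1 \<Gamma>\<^sub>2 \<Gamma>\<^sub>3 \<Gamma>\<^sub>4"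
abbreviation "\<rho>\<^sub>3 \<equiv> mu_rho3 N \<gamma> \<Gamma>\<^sub>1 \<Gamma>\<^sub>2 \<Gamma>\<^sub>3 \<Gamma>\<^sub>4"
abbreviation "\<rho> \<equiv> mu_rho N \<gamma> \<Gamma>\<^sub>1 \<Gamma>\<^sub>2 \<Gamma>\<^sub>3 \<Gamma>\<^sub>4"

lemma N_ge_1: "real N \<ge> 1" using N_pos by simp

lemma b_bounds: "0 \<le> b n" "b n \<le> 1"
  using b_ge[of n] b_le[of n] \<gamma>_pos by auto

section \<open>Boundedness\<close>

lemma mann_step_dist_le:
  assumes "T q = q"
  shows "norm (x (2 * n + 2) - q) \<le> norm (x (2 * n + 1) - q)"
proof -
  let ?w = "x (2 * n + 1)"
  have "x (2 * n + 2) - q = (1 - b n) *\<^sub>R (T ?w - T q) + b n *\<^sub>R (?w - q)"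
    by (simp only: mann_step assms) (simp add: algebra_simps)
  then have "norm (x (2 * n + 2) - q) \<le> (1 - b n) * norm (T ?w - T q) + b n * norm (?w - q)"
    using norm_triangle_ineq[of "(1 - b n) *\<^sub>R (T ?w - T q)" "b n *\<^sub>R (?w - q)"] b_bounds[of n]
    by simp
  also have "\<dots> \<le> (1 - b n) * norm (?w - q) + b n * norm (?w - q)"
    using nonexpansive b_bounds[of n] by (intro add_right_mono mult_left_mono) auto
  finally show ?thesis by (simp add: algebra_simps)
qed

lemma halpern_step_dist:
  "x (2 * n + 1) - q = (1 - \<alpha> n) *\<^sub>R (x (2 * n) - q) + \<alpha> n *\<^sub>R (u - q)"
  by (simp only: halpern_step) (simp add: algebra_simps)

lemma x_bounded: "norm (x n - p) \<le> N"
proof -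
  have odd: "norm (x (2 * k + 1) - p) \<le> N" if "norm (x (2 * k) - p) \<le> N" for k
  proof -
    have "norm (x (2 * k + 1) - p) \<le> (1 - \<alpha> k) * norm (x (2 * k) - p) + \<alpha> k * norm (u - p)"
      unfolding halpern_step_dist
      using norm_triangle_ineq[of "(1 - \<alpha> k) *\<^sub>R (x (2 * k) - p)" "\<alpha> k *\<^sub>R (u - p)"]
        \<alpha>_nonneg[of k] \<alpha>_le[of k] by simp
    also have "\<dots> \<le> (1 - \<alpha> k) * N + \<alpha> k * N"
      using that u_bound \<alpha>_nonneg[of k] \<alpha>_le[of k] norm_ge_zero[of "u - p"]
      by (intro add_mono mult_left_mono) linarith+
    finally show ?thesis by (simp add: algebra_simps)
  qed
  have even: "norm (x (2 * k) - p) \<le> N" for k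
  proof (induction k)
    case (Suc k)
    show ?case using mann_step_dist_le[OF fixed, of k] odd[OF Suc] by simp
  qed (simp add: x_0)
  show ?thesis using even odd by (cases "even n") (auto elim!: evenE oddE)
qed

lemma ball_dist_le: "norm (v - p) \<le> N \<Longrightarrow> norm (w - p) \<le> N \<Longrightarrow> norm (v - w) \<le> 2 * N"
  using norm_triangle_ineq4[of "v - p" "w - p"] by simp

lemma anchor_dist_le: "norm (w - p) \<le> N \<Longrightarrow> norm (u - w) \<le> 3 / 2 * N"
  using norm_triangle_ineq4[of "u - p" "w - p"] u_bound by simp

lemma residual_bounded: "norm (w - p) \<le> N \<Longrightarrow> norm (T w - w) \<le> 2 * N"
  using nonexpansive[of w p] fixed by (intro ball_dist_le) auto

section \<open>Asymptotic regularity\<close>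

lemma even_increment_step:
  "norm (x (2 * (n + 1) + 2) - x (2 * (n + 1)))
    \<le> (1 - \<alpha> (n + 1)) * norm (x (2 * n + 2) - x (2 * n))
      + 2 * N * (\<bar>\<alpha> (n + 1) - \<alpha> n\<bar> + \<bar>b (n + 1) - b n\<bar>)"
proof -
  define w where "w = (\<lambda>n. x (2 * n + 1))"
  have x_next: "x (2 * (n + 1)) = x (2 * n + 2)" by simp
  have "x (2 * (n + 1) + 2) - x (2 * n + 2)
      = (1 - b (n + 1)) *\<^sub>R (T (w (n + 1)) - T (w n)) + b (n + 1) *\<^sub>R (w (n + 1) - w n)
        + (b n - b (n + 1)) *\<^sub>R (T (w n) - w n)"
    unfolding mann_step[of "n + 1"] mann_step[of n] by (simp add: w_def algebra_simps)
  then have "norm (x (2 * (n + 1) + 2) - x (2 * n + 2))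
      \<le> norm ((1 - b (n + 1)) *\<^sub>R (T (w (n + 1)) - T (w n))) + norm (b (n + 1) *\<^sub>R (w (n + 1) - w n))
        + norm ((b n - b (n + 1)) *\<^sub>R (T (w n) - w n))"
    using norm_triangle_ineq norm_triangle_mono by (metis order_refl)
  also have "\<dots> = (1 - b (n + 1)) * norm (T (w (n + 1)) - T (w n)) + b (n + 1) * norm (w (n + 1) - w n)
        + \<bar>b (n + 1) - b n\<bar> * norm (T (w n) - w n)"
    using b_bounds[of "n + 1"] by (simp add: abs_minus_commute)
  also have "\<dots> \<le> (1 - b (n + 1)) * norm (w (n + 1) - w n) + b (n + 1) * norm (w (n + 1) - w n)
        + \<bar>b (n + 1) - b n\<bar> * (2 * N)"
    using b_bounds[of "n + 1"] residual_bounded[OF x_bounded]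
    by (intro add_mono mult_left_mono nonexpansive order_refl) (auto simp: w_def)
  finally have mann: "norm (x (2 * (n + 1) + 2) - x (2 * n + 2))
      \<le> norm (w (n + 1) - w n) + 2 * N * \<bar>b (n + 1) - b n\<bar>"
    by (simp add: algebra_simps)
  have "w (n + 1) - w n = (1 - \<alpha> (n + 1)) *\<^sub>R (x (2 * n + 2) - x (2 * n))
      + (\<alpha> (n + 1) - \<alpha> n) *\<^sub>R (u - x (2 * n))"
    unfolding w_def halpern_step x_next by (simp add: algebra_simps)
  then have "norm (w (n + 1) - w n) \<le> (1 - \<alpha> (n + 1)) * norm (x (2 * n + 2) - x (2 * n))
      + \<bar>\<alpha> (n + 1) - \<alpha> n\<bar> * norm (u - x (2 * n))"
    using norm_triangle_ineq[of "(1 - \<alpha> (n + 1)) *\<^sub>R (x (2 * n + 2) - x (2 * n))"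
        "(\<alpha> (n + 1) - \<alpha> n) *\<^sub>R (u - x (2 * n))"] \<alpha>_le[of "n + 1"] by simp
  also have "\<dots> \<le> (1 - \<alpha> (n + 1)) * norm (x (2 * n + 2) - x (2 * n)) + \<bar>\<alpha> (n + 1) - \<alpha> n\<bar> * (2 * N)"
    using anchor_dist_le[OF x_bounded, of "2 * n"]
    by (intro add_left_mono mult_left_mono) auto
  finally show ?thesis using mann unfolding x_next by (simp add: algebra_simps)
qed

text \<open>The recurrence is started at the index \<open>K\<close> from which the variations of \<open>\<alpha>\<close> and \<open>b\<close> contribute at most
  \<open>\<epsilon> / 2\<close>. The other half of \<open>\<epsilon>\<close> is for the initial increment, at most \<open>2 N\<close>, damped by the divergence
  of the sum of the \<open>\<alpha> i\<close>.\<close>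
lemma even_increment_rate:
  assumes \<epsilon>: "\<epsilon> > 0" and n: "n \<ge> \<theta>\<^sub>1 \<epsilon>"
  shows "norm (x (2 * n + 2) - x (2 * n)) \<le> \<epsilon>"
proof -
  define K where "K = V (\<epsilon> / 2) + 1"
  define L where "L = nat \<lceil>ln (4 * real N / \<epsilon>)\<rceil>"
  define e where "e = \<epsilon> / 2 / (4 * real N)"
  have e: "e > 0" using \<epsilon> N_pos by (simp add: e_def)
  have \<theta>\<^sub>1: "\<theta>\<^sub>1 \<epsilon> = \<Gamma>\<^sub>2 (K + 1 + L) + 1" by (simp add: mu_theta1_def K_def L_def add_ac)
  \<comment> \<open>At least \<open>k\<close> terms are needed for a sum of \<open>k\<close>, so \<open>\<theta>\<^sub>1 \<epsilon>\<close> lies beyond \<open>K\<close>.\<close>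
  have sum_le: "real (K + 1 + L) \<le> real (\<Gamma>\<^sub>2 (K + 1 + L) + 1)"
    using rate_sum_\<alpha>[of "K + 1 + L"] sum_bounded_above[of "{0..\<Gamma>\<^sub>2 (K + 1 + L)}" \<alpha> 1] \<alpha>_le
    by simp
  define m where "m = n - K"
  have n_eq: "n = K + m" using n sum_le unfolding \<theta>\<^sub>1 m_def by simp
  define s where "s = (\<lambda>k. norm (x (2 * (K + k) + 2) - x (2 * (K + k))))"
  define c where "c = (\<lambda>k. 2 * real N * (\<bar>\<alpha> (K + k + 1) - \<alpha> (K + k)\<bar> + \<bar>b (K + k + 1) - b (K + k)\<bar>))"
  have "s m \<le> exp (- (\<Sum>k<m. \<alpha> (K + 1 + k))) * s 0 + 0 + (\<Sum>k<m. c k)"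
  proof (rule contracting_recurrence_bound)
    fix k show "s (Suc k) \<le> (1 - \<alpha> (K + 1 + k)) * s k + \<alpha> (K + 1 + k) * 0 + c k"
      using even_increment_step[of "K + k"] by (simp add: s_def c_def add_ac)
  qed (auto simp: \<alpha>_nonneg \<alpha>_le c_def s_def)
  moreover have "exp (- (\<Sum>k<m. \<alpha> (K + 1 + k))) * s 0 \<le> \<epsilon> / 2"
  proof -
    have "real L \<le> (\<Sum>k<m. \<alpha> (K + 1 + k))"
      using n unfolding \<theta>\<^sub>1 n_eq
      by (intro sum_ge_of_rate_of_divergence[where \<Gamma> = "\<Gamma>\<^sub>2 (K + 1 + L)"] \<alpha>_nonneg \<alpha>_le rate_sum_\<alpha>) simp
    moreover have "ln (4 * real N / \<epsilon>) \<le> real L" unfolding L_def by (rule real_nat_ceiling_ge)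
    ultimately have "exp (- (\<Sum>k<m. \<alpha> (K + 1 + k))) \<le> exp (- ln (4 * real N / \<epsilon>))" by simp
    also have "\<dots> = \<epsilon> / (4 * real N)" using \<epsilon> N_pos by (simp add: exp_minus)
    finally have "exp (- (\<Sum>k<m. \<alpha> (K + 1 + k))) * s 0 \<le> \<epsilon> / (4 * real N) * (2 * real N)"
      unfolding s_def using ball_dist_le[OF x_bounded x_bounded] \<epsilon> by (intro mult_mono) auto
    then show ?thesis using N_pos by simp
  qed
  moreover have "(\<Sum>k<m. c k) \<le> \<epsilon> / 2"
  proof -
    have "V (\<epsilon> / 2) = max (\<Gamma>\<^sub>3 e) (\<Gamma>\<^sub>4 e)" by (simp add: mu_V_def e_def)
    then have "\<Gamma>\<^sub>3 e \<le> V (\<epsilon> / 2)" "\<Gamma>\<^sub>4 e \<le> V (\<epsilon> / 2)" by simp_all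
    then have "(\<Sum>k<m. \<bar>\<alpha> (V (\<epsilon> / 2) + 1 + k + 1) - \<alpha> (V (\<epsilon> / 2) + 1 + k)\<bar>) \<le> e"
      "(\<Sum>k<m. \<bar>b (V (\<epsilon> / 2) + 1 + k + 1) - b (V (\<epsilon> / 2) + 1 + k)\<bar>) \<le> e"
      using sum_tail_le[OF _ rate_var_\<alpha>[OF e]] sum_tail_le[OF _ rate_var_b[OF e]] by simp_all
    then have "(\<Sum>k<m. \<bar>\<alpha> (K + k + 1) - \<alpha> (K + k)\<bar>) + (\<Sum>k<m. \<bar>b (K + k + 1) - b (K + k)\<bar>) \<le> 2 * e"
      unfolding K_def by linarith
    then have "2 * real N * ((\<Sum>k<m. \<bar>\<alpha> (K + k + 1) - \<alpha> (K + k)\<bar>) + (\<Sum>k<m. \<bar>b (K + k + 1) - b (K + k)\<bar>))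
        \<le> 2 * real N * (2 * e)"
      by (intro mult_left_mono) simp_all
    also have "2 * real N * (2 * e) = \<epsilon> / 2" using N_pos by (simp add: e_def)
    finally show ?thesis by (simp add: c_def sum.distrib flip: sum_distrib_left)
  qed
  ultimately show ?thesis unfolding n_eq s_def by simp
qed

text \<open>The Mann step decreases the squared distance to \<open>p\<close> by \<open>b (1 - b)\<close> times the squared residual, by strict
  convexity of the norm. As the squared distances at the even indices \<open>2 n\<close> and \<open>2 n + 2\<close> are close together and the Halpern step
  adds at most a multiple of \<open>\<alpha> n\<close>, the residual must be small.\<close>
lemma residual_energy:
  "\<gamma>\<^sup>2 * (norm (T (x (2 * n + 1)) - x (2 * n + 1)))\<^sup>2
    \<le> 2 * N * norm (x (2 * n + 2) - x (2 * n)) + \<alpha> n * (real N)\<^sup>2 / 4"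
proof -
  let ?w = "x (2 * n + 1)"
  have "x (2 * n + 2) - p = (1 - b n) *\<^sub>R (T ?w - p) + b n *\<^sub>R (?w - p)"
    by (simp only: mann_step) (simp add: algebra_simps)
  then have "(norm (x (2 * n + 2) - p))\<^sup>2
      = (1 - b n) * (norm (T ?w - T p))\<^sup>2 + b n * (norm (?w - p))\<^sup>2
        - b n * (1 - b n) * (norm (T ?w - ?w))\<^sup>2"
    using convex_combination_quadratic[of "b n" "T ?w - p" "?w - p"] by (simp add: fixed)
  also have "\<dots> \<le> (1 - b n) * (norm (?w - p))\<^sup>2 + b n * (norm (?w - p))\<^sup>2
        - \<gamma>\<^sup>2 * (norm (T ?w - ?w))\<^sup>2"
  proof -
    have "\<gamma> * \<gamma> \<le> b n * (1 - b n)"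
      using b_ge[of n] b_le[of n] \<gamma>_pos by (intro mult_mono) auto
    then show ?thesis using b_bounds[of n] nonexpansive unfolding power2_eq_square[of \<gamma>]
      by (intro diff_mono add_right_mono mult_left_mono mult_right_mono power_mono) auto
  qed
  also have "\<dots> = (norm (?w - p))\<^sup>2 - \<gamma>\<^sup>2 * (norm (T ?w - ?w))\<^sup>2" by (simp add: algebra_simps)
  finally have mann: "\<gamma>\<^sup>2 * (norm (T ?w - ?w))\<^sup>2 \<le> (norm (?w - p))\<^sup>2 - (norm (x (2 * n + 2) - p))\<^sup>2"
    by simp
  have "(norm (?w - p))\<^sup>2 = (1 - \<alpha> n) * (norm (x (2 * n) - p))\<^sup>2 + \<alpha> n * (norm (u - p))\<^sup>2
      - \<alpha> n * (1 - \<alpha> n) * (norm (x (2 * n) - p - (u - p)))\<^sup>2"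
    unfolding halpern_step_dist by (rule convex_combination_quadratic)
  also have "\<dots> \<le> 1 * (norm (x (2 * n) - p))\<^sup>2 + \<alpha> n * (real N / 2)\<^sup>2 - 0"
    using \<alpha>_nonneg[of n] \<alpha>_le[of n] u_bound
    by (intro diff_mono add_mono mult_right_mono mult_left_mono power_mono) auto
  finally have halpern: "(norm (?w - p))\<^sup>2 \<le> (norm (x (2 * n) - p))\<^sup>2 + \<alpha> n * (real N)\<^sup>2 / 4"
    by (simp add: power_divide)
  have "(norm (x (2 * n) - p))\<^sup>2 - (norm (x (2 * n + 2) - p))\<^sup>2
      = (norm (x (2 * n) - p) + norm (x (2 * n + 2) - p)) * (norm (x (2 * n) - p) - norm (x (2 * n + 2) - p))"
    by (simp add: power2_eq_square algebra_simps)
  also have "\<dots> \<le> (norm (x (2 * n) - p) + norm (x (2 * n + 2) - p)) * norm (x (2 * n + 2) - x (2 * n))"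
    using norm_triangle_ineq2[of "x (2 * n) - p" "x (2 * n + 2) - p"]
    by (intro mult_left_mono) (auto simp: norm_minus_commute)
  also have "\<dots> \<le> (2 * real N) * norm (x (2 * n + 2) - x (2 * n))"
    using x_bounded[of "2 * n"] x_bounded[of "2 * n + 2"] by (intro mult_right_mono) auto
  finally show ?thesis using mann halpern by simp
qed

lemma residual_rate_odd:
  assumes \<epsilon>: "\<epsilon> > 0" and n: "n \<ge> \<theta>\<^sub>3 \<epsilon>"
  shows "norm (T (x (2 * n + 1)) - x (2 * n + 1)) \<le> \<epsilon>"
proof -
  let ?D = "norm (T (x (2 * n + 1)) - x (2 * n + 1))"
  have g\<epsilon>: "(\<gamma> * \<epsilon>)\<^sup>2 > 0" using \<epsilon> \<gamma>_pos by simp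
  have "norm (x (2 * n + 2) - x (2 * n)) \<le> (\<gamma> * \<epsilon>)\<^sup>2 / (8 * real N)"
    using n g\<epsilon> N_pos by (intro even_increment_rate) (auto simp: mu_theta3_def)
  then have "2 * real N * norm (x (2 * n + 2) - x (2 * n)) \<le> (\<gamma> * \<epsilon>)\<^sup>2 / 4"
    using N_pos by (simp add: field_simps)
  moreover have "\<alpha> n \<le> (\<gamma> * \<epsilon>)\<^sup>2 / (2 * (real N)\<^sup>2)"
    using n g\<epsilon> N_pos by (intro rate_\<alpha>) (auto simp: mu_theta3_def)
  then have "\<alpha> n * (real N)\<^sup>2 / 4 \<le> (\<gamma> * \<epsilon>)\<^sup>2 / 8"
    using N_pos by (simp add: field_simps)
  ultimately have "\<gamma>\<^sup>2 * ?D\<^sup>2 \<le> (\<gamma> * \<epsilon>)\<^sup>2"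
    using residual_energy[of n] g\<epsilon> by linarith
  then have "(\<gamma> * ?D)\<^sup>2 \<le> (\<gamma> * \<epsilon>)\<^sup>2" by (simp add: power_mult_distrib)
  then have "\<gamma> * ?D \<le> \<gamma> * \<epsilon>" by (rule power2_le_imp_le) (use \<gamma>_pos \<epsilon> in simp)
  then show ?thesis using \<gamma>_pos by simp
qed

lemma mann_displacement_le:
  "norm (x (2 * n + 2) - x (2 * n + 1)) \<le> norm (T (x (2 * n + 1)) - x (2 * n + 1))"
proof -
  have "x (2 * n + 2) - x (2 * n + 1) = (1 - b n) *\<^sub>R (T (x (2 * n + 1)) - x (2 * n + 1))"
    by (simp only: mann_step) (simp add: algebra_simps)
  then show ?thesis using b_bounds[of n] by (simp add: mult_left_le_one_le)
qed

lemma halpern_displacement_rate: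
  assumes \<epsilon>: "\<epsilon> > 0" and n: "n \<ge> \<theta>\<^sub>4 \<epsilon>"
  shows "norm (x (2 * n + 1) - x (2 * n)) \<le> \<epsilon>"
proof -
  have "norm (x (2 * n + 2) - x (2 * n)) \<le> \<epsilon> / 2"
    using \<epsilon> n by (intro even_increment_rate) (auto simp: mu_theta4_def)
  moreover have "norm (T (x (2 * n + 1)) - x (2 * n + 1)) \<le> \<epsilon> / 2"
    using \<epsilon> n by (intro residual_rate_odd) (auto simp: mu_theta4_def)
  ultimately show ?thesis
    using mann_displacement_le[of n] norm_triangle_ineq4[of "x (2 * n + 2) - x (2 * n)" "x (2 * n + 2) - x (2 * n + 1)"]
    by simp
qed

lemma residual_rate:
  assumes \<epsilon>: "\<epsilon> > 0" and n: "n \<ge> \<rho>\<^sub>2 \<epsilon>"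
  shows "norm (T (x n) - x n) \<le> \<epsilon>"
proof -
  have n: "n \<ge> 2 * \<theta>\<^sub>3 (\<epsilon> / 3) + 2" using n by (simp add: mu_rho2_def)
  have odd: "norm (T (x (2 * k + 1)) - x (2 * k + 1)) \<le> \<epsilon> / 3" if "k \<ge> \<theta>\<^sub>3 (\<epsilon> / 3)" for k
    using \<epsilon> that by (intro residual_rate_odd) auto
  show ?thesis
  proof (cases "even n")
    case True
    then obtain j where "n = 2 * j" by (elim evenE)
    then obtain k where k: "n = 2 * k + 2" using n by (cases j) auto
    then have D: "norm (T (x (2 * k + 1)) - x (2 * k + 1)) \<le> \<epsilon> / 3" using n by (intro odd) simp
    have "T (x n) - x n = (T (x n) - T (x (2 * k + 1))) + (T (x (2 * k + 1)) - x (2 * k + 1))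
        + (x (2 * k + 1) - x n)" by simp
    then have "norm (T (x n) - x n) \<le> norm (T (x n) - T (x (2 * k + 1)))
        + norm (T (x (2 * k + 1)) - x (2 * k + 1)) + norm (x (2 * k + 1) - x n)"
      using norm_triangle_ineq norm_triangle_mono by (metis order_refl)
    also have "\<dots> \<le> 3 * norm (T (x (2 * k + 1)) - x (2 * k + 1))"
      using nonexpansive[of "x n" "x (2 * k + 1)"] mann_displacement_le[of k]
      by (simp add: k norm_minus_commute)
    finally show ?thesis using D by simp
  next
    case False
    then obtain k where k: "n = 2 * k + 1" by (elim oddE)
    then have "norm (T (x (2 * k + 1)) - x (2 * k + 1)) \<le> \<epsilon> / 3" using n by (intro odd) simp
    then show ?thesis using \<epsilon> k by simp
  qed
qed

section \<open>Monotonicity\<close>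

lemma V_anti: "0 < \<epsilon> \<Longrightarrow> \<epsilon> \<le> \<epsilon>' \<Longrightarrow> V \<epsilon>' \<le> V \<epsilon>"
  unfolding mu_V_def using N_pos
  by (intro max.mono monotone_onD[OF \<Gamma>\<^sub>3_anti] monotone_onD[OF \<Gamma>\<^sub>4_anti] divide_right_mono) auto

lemma \<theta>\<^sub>1_anti: "0 < \<epsilon> \<Longrightarrow> \<epsilon> \<le> \<epsilon>' \<Longrightarrow> \<theta>\<^sub>1 \<epsilon>' \<le> \<theta>\<^sub>1 \<epsilon>"
  unfolding mu_theta1_def using N_pos
  by (intro add_mono order_refl monoD[OF \<Gamma>\<^sub>2_mono] V_anti nat_mono ceiling_mono)
    (auto intro!: divide_left_mono)

lemma \<theta>\<^sub>3_anti:
  assumes "0 < \<epsilon>" "\<epsilon> \<le> \<epsilon>'"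
  shows "\<theta>\<^sub>3 \<epsilon>' \<le> \<theta>\<^sub>3 \<epsilon>"
proof -
  have "(\<gamma> * \<epsilon>)\<^sup>2 \<le> (\<gamma> * \<epsilon>')\<^sup>2" "0 < (\<gamma> * \<epsilon>)\<^sup>2" "0 < (\<gamma> * \<epsilon>')\<^sup>2"
    using assms \<gamma>_pos by (auto intro!: power_mono mult_left_mono)
  then show ?thesis unfolding mu_theta3_def using N_pos
    by (intro max.mono \<theta>\<^sub>1_anti monotone_onD[OF \<Gamma>\<^sub>1_anti] divide_right_mono) auto
qed

lemma \<rho>_anti: "0 < \<epsilon> \<Longrightarrow> \<epsilon> \<le> \<epsilon>' \<Longrightarrow> \<rho> \<epsilon>' \<le> \<rho> \<epsilon>"
  unfolding mu_rho_def mu_rho2_def mu_rho3_def mu_theta4_def using N_pos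
  by (intro max.mono add_mono mult_le_mono2 order_refl \<theta>\<^sub>1_anti \<theta>\<^sub>3_anti
      monotone_onD[OF \<Gamma>\<^sub>1_anti] divide_right_mono) auto

section \<open>Approximate projection\<close>

lemma iterate_in_unit:
  fixes \<delta> :: "real \<Rightarrow> real"
  assumes "\<And>\<xi>. \<xi> \<in> {0<..1} \<Longrightarrow> \<delta> \<xi> \<in> {0<..1}"
  shows "(\<delta> ^^ i) 1 \<in> {0<..1}"
  using assms by (induction i) auto

lemma mu_phi_pos:
  assumes "\<And>\<xi>. \<xi> \<in> {0<..1} \<Longrightarrow> \<delta> \<xi> \<in> {0<..1}"
  shows "mu_phi N e \<delta> > 0"
proof -
  have "0 < (\<delta> ^^ i) 1" for i using iterate_in_unit[of \<delta> i, OF assms] by simp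
  then show ?thesis by (simp add: mu_phi_def del: funpow.simps)
qed

text \<open>A quantitative substitute for the projection of \<open>u\<close> onto the fixed point set. If no pair worked, then from an
  approximate fixed point at the level \<open>\<delta>\<^sup>i\<^sup>+\<^sup>1(1)\<close> one could pass to one at the level
  \<open>\<delta>\<^sup>i(1)\<close> whose squared distance to \<open>u\<close> is smaller by \<open>e\<close>. Starting from \<open>p\<close>, which is approximate at
  every level, with squared distance at most \<open>N\<^sup>2 / 4\<close>, this is impossible more than \<open>N\<^sup>2 / (4 e)\<close> times.\<close>
lemma approximate_projection:
  assumes e: "e > 0" and \<delta>: "\<And>\<xi>. \<xi> \<in> {0<..1} \<Longrightarrow> \<delta> \<xi> \<in> {0<..1}"
  shows "\<exists>\<xi>\<in>{0<..1}. \<exists>v. mu_phi N e \<delta> \<le> \<xi> \<and> norm (v - p) \<le> N \<and> norm (T v - v) \<le> \<delta> \<xi> \<and>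
    (\<forall>w. norm (w - p) \<le> N \<longrightarrow> norm (T w - w) \<le> \<xi> \<longrightarrow> (norm (u - v))\<^sup>2 \<le> (norm (u - w))\<^sup>2 + e)"
proof (rule ccontr)
  assume no_solution: "\<not> ?thesis"
  have none: "\<exists>w. norm (w - p) \<le> N \<and> norm (T w - w) \<le> \<xi> \<and> (norm (u - w))\<^sup>2 + e < (norm (u - v))\<^sup>2"
    if "\<xi> \<in> {0<..1}" "mu_phi N e \<delta> \<le> \<xi>" "norm (v - p) \<le> N" "norm (T v - v) \<le> \<delta> \<xi>" for \<xi> v
  proof (rule ccontr)
    assume "\<not> ?thesis"
    then have "\<forall>w. norm (w - p) \<le> N \<longrightarrow> norm (T w - w) \<le> \<xi> \<longrightarrow> (norm (u - v))\<^sup>2 \<le> (norm (u - w))\<^sup>2 + e"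
      unfolding not_less[symmetric] by blast
    with that have "\<exists>\<xi>\<in>{0<..1}. \<exists>v. mu_phi N e \<delta> \<le> \<xi> \<and> norm (v - p) \<le> N \<and> norm (T v - v) \<le> \<delta> \<xi> \<and>
        (\<forall>w. norm (w - p) \<le> N \<longrightarrow> norm (T w - w) \<le> \<xi> \<longrightarrow> (norm (u - v))\<^sup>2 \<le> (norm (u - w))\<^sup>2 + e)"
      by (intro bexI[of _ \<xi>] exI[of _ v] conjI)
    with no_solution show False by (rule notE)
  qed
  define r where "r = nat \<lceil>(real N)\<^sup>2 / (4 * e)\<rceil>"
  have descent: "\<exists>v. norm (v - p) \<le> N \<and> norm (T v - v) \<le> (\<delta> ^^ (Suc r - j)) 1 \<and>
      (norm (u - v))\<^sup>2 \<le> (real N)\<^sup>2 / 4 - real j * e" if "j \<le> Suc r" for j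
    using that
  proof (induction j)
    case 0
    have "(norm (u - p))\<^sup>2 \<le> (real N / 2)\<^sup>2" using u_bound by (intro power_mono) auto
    then show ?case using iterate_in_unit[of \<delta> "Suc r", OF \<delta>] fixed
      by (intro exI[of _ p]) (auto simp: power_divide)
  next
    case (Suc j)
    define \<xi> where "\<xi> = (\<delta> ^^ (r - j)) 1"
    obtain v where v: "norm (v - p) \<le> N" "norm (T v - v) \<le> \<delta> \<xi>"
      "(norm (u - v))\<^sup>2 \<le> (real N)\<^sup>2 / 4 - real j * e"
    proof -
      have "Suc r - j = Suc (r - j)" using Suc.prems by simp
      then have "(\<delta> ^^ (Suc r - j)) 1 = \<delta> \<xi>" by (simp only: \<xi>_def funpow.simps comp_apply)
      then show ?thesis using Suc.IH Suc.prems that by auto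
    qed
    have \<xi>: "\<xi> \<in> {0<..1}" unfolding \<xi>_def by (rule iterate_in_unit[of \<delta>, OF \<delta>])
    have "mu_phi N e \<delta> \<le> \<xi>"
      unfolding mu_phi_def \<xi>_def r_def[symmetric] by (intro Min_le) auto
    then obtain w where "norm (w - p) \<le> N" "norm (T w - w) \<le> \<xi>"
      "(norm (u - w))\<^sup>2 + e < (norm (u - v))\<^sup>2"
      using none[OF \<xi> _ v(1,2)] by blast
    moreover from this(3) have "(norm (u - w))\<^sup>2 \<le> (real N)\<^sup>2 / 4 - real (Suc j) * e"
      using v(3) by (simp add: distrib_right)
    ultimately show ?case unfolding diff_Suc_Suc \<xi>_def by blast
  qed
  have "\<exists>v. (norm (u - v))\<^sup>2 \<le> (real N)\<^sup>2 / 4 - real (Suc r) * e"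
    using descent[OF order_refl] by (elim ex_forward) simp
  then obtain v where v: "(norm (u - v))\<^sup>2 \<le> (real N)\<^sup>2 / 4 - real (Suc r) * e" ..
  have "(real N)\<^sup>2 / (4 * e) \<le> real r" unfolding r_def by (rule real_nat_ceiling_ge)
  then have "(real N)\<^sup>2 / 4 \<le> real r * e" using e by (simp add: field_simps)
  then have "(real N)\<^sup>2 / 4 - real (Suc r) * e < 0" using e by (simp add: algebra_simps)
  from order_le_less_trans[OF v this] show False by simp
qed

text \<open>Compare \<open>v\<close> with the points \<open>m\<close> of the segment from \<open>v\<close> to \<open>w\<close>. The tolerance \<open>\<eta> = \<xi>\<^sup>2 / (24 N)\<close>
  for the endpoints ensures that \<open>m\<close> is a \<open>\<xi>\<close>-approximate fixed point, so that \<open>v\<close> is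
  \<open>e'\<close>-almost nearest to \<open>u\<close> compared with \<open>m\<close>. Expanding the square and dividing by \<open>t\<close> gives the
  variational inequality up to \<open>2 N\<^sup>2 t + e' / (2 t)\<close>.\<close>
lemma approximate_variational_inequality:
  assumes e: "e > 0" and \<delta>: "\<And>\<eta>. \<eta> \<in> {0<..1} \<Longrightarrow> \<delta> \<eta> \<in> {0<..1}"
  shows "\<exists>\<eta>\<in>{0<..1}. \<exists>v. mu_Phi N e \<delta> > 0 \<and> mu_Phi N e \<delta> \<le> \<eta> \<and> norm (v - p) \<le> N \<and> norm (T v - v) \<le> \<delta> \<eta> \<and>
    (\<forall>w. norm (w - p) \<le> N \<longrightarrow> norm (T w - w) \<le> \<eta> \<longrightarrow> (u - v) \<bullet> (w - v) \<le> e)"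
proof -
  define \<delta>' where "\<delta>' = (\<lambda>\<xi>. min (\<delta> (\<xi>\<^sup>2 / (24 * real N))) (\<xi>\<^sup>2 / (24 * real N)))"
  define e' where "e' = e\<^sup>2 / (4 * (real N)\<^sup>2)"
  have e': "e' > 0" using e N_pos by (simp add: e'_def)
  have in_unit: "\<xi>\<^sup>2 / (24 * real N) \<in> {0<..1}" if "\<xi> \<in> {0<..1}" for \<xi> :: real
  proof -
    have "\<xi>\<^sup>2 \<le> 1" using that by (simp add: power_le_one)
    then show ?thesis using that N_ge_1 by (simp add: field_simps)
  qed
  have \<delta>': "\<delta>' \<xi> \<in> {0<..1}" if "\<xi> \<in> {0<..1}" for \<xi>
    using in_unit[OF that] \<delta>[OF in_unit[OF that]] by (auto simp: \<delta>'_def min_def)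
  obtain \<xi> v where \<xi>: "\<xi> \<in> {0<..1}" "mu_phi N e' \<delta>' \<le> \<xi>" and v: "norm (v - p) \<le> N" "norm (T v - v) \<le> \<delta>' \<xi>"
    and v_min: "\<And>w. norm (w - p) \<le> N \<Longrightarrow> norm (T w - w) \<le> \<xi> \<Longrightarrow> (norm (u - v))\<^sup>2 \<le> (norm (u - w))\<^sup>2 + e'"
    using approximate_projection[of e' \<delta>', OF e' \<delta>'] by blast
  define \<eta> where "\<eta> = \<xi>\<^sup>2 / (24 * real N)"
  have \<eta>: "\<eta> \<in> {0<..1}" unfolding \<eta>_def by (rule in_unit[OF \<xi>(1)])
  have Tv: "norm (T v - v) \<le> \<delta> \<eta>" "norm (T v - v) \<le> \<eta>" using v(2) by (simp_all add: \<delta>'_def \<eta>_def)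
  have Phi: "mu_Phi N e \<delta> = (mu_phi N e' \<delta>')\<^sup>2 / (24 * real N)"
    by (simp add: mu_Phi_def e'_def \<delta>'_def)
  have phi_pos: "mu_phi N e' \<delta>' > 0" by (rule mu_phi_pos[of \<delta>', OF \<delta>'])
  have "mu_Phi N e \<delta> > 0" unfolding Phi using phi_pos N_pos by simp
  moreover have "mu_Phi N e \<delta> \<le> \<eta>"
    unfolding Phi \<eta>_def using phi_pos \<xi>(2) by (intro divide_right_mono power_mono) auto
  moreover have "(u - v) \<bullet> (w - v) \<le> e" if w: "norm (w - p) \<le> N" "norm (T w - w) \<le> \<eta>" for w
    \<comment> \<open>For larger \<open>e\<close> the fraction \<open>t\<close> used below would exceed \<open>1\<close>, but then boundedness suffices.\<close>
  proof (cases "e \<le> 4 * (real N)\<^sup>2")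
    case False
    have "(u - v) \<bullet> (w - v) \<le> norm (u - v) * norm (w - v)" by (rule norm_cauchy_schwarz)
    also have "\<dots> \<le> (3 / 2 * real N) * (2 * real N)"
      using anchor_dist_le[OF v(1)] ball_dist_le[OF w(1) v(1)] by (intro mult_mono) auto
    also have "\<dots> \<le> e" using False zero_le_power2[of "real N"] unfolding power2_eq_square by linarith
    finally show ?thesis .
  next
    case True
    \<comment> \<open>This minimises \<open>2 N\<^sup>2 t + e' / (2 t)\<close>; the minimum is \<open>e\<close>.\<close>
    define t where "t = e / (4 * (real N)\<^sup>2)"
    have t: "0 < t" "t \<le> 1" using e N_pos True by (simp_all add: t_def)
    define m where "m = (1 - t) *\<^sub>R v + t *\<^sub>R w"
    define d where "d = norm (v - w)"
    have d: "0 \<le> d" "d \<le> 2 * N" using ball_dist_le[OF v(1) w(1)] by (simp_all add: d_def)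
    have "m - p = (1 - t) *\<^sub>R (v - p) + t *\<^sub>R (w - p)" by (simp add: m_def algebra_simps)
    then have "norm (m - p) \<le> (1 - t) * norm (v - p) + t * norm (w - p)"
      using norm_triangle_ineq[of "(1 - t) *\<^sub>R (v - p)" "t *\<^sub>R (w - p)"] t by simp
    also have "\<dots> \<le> (1 - t) * N + t * N" using t v w by (intro add_mono mult_left_mono) auto
    finally have m_in: "norm (m - p) \<le> N" by (simp add: algebra_simps)
    have "(norm (T m - m))\<^sup>2 \<le> \<eta> * d + \<eta>\<^sup>2"
      unfolding m_def d_def using nonexpansive Tv(2) w(2) t
      by (intro nonexpansive_approx_fixed_segment) auto
    also have "\<dots> \<le> \<eta> * (2 * real N) + \<eta> * 1"
      using \<eta> d unfolding power2_eq_square by (intro add_mono mult_left_mono) auto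
    also have "\<dots> \<le> \<eta> * (24 * real N)" using \<eta> N_ge_1
      by (simp flip: distrib_left)
    also have "\<dots> = \<xi>\<^sup>2" using N_pos by (simp add: \<eta>_def)
    finally have "norm (T m - m) \<le> \<xi>" by (rule power2_le_imp_le) (use \<xi> in simp)
    then have "(norm (u - v))\<^sup>2 \<le> (norm (u - m))\<^sup>2 + e'" by (rule v_min[OF m_in])
    also have "u - m = (u - v) - t *\<^sub>R (w - v)" by (simp add: m_def algebra_simps)
    also have "(norm ((u - v) - t *\<^sub>R (w - v)))\<^sup>2
        = (norm (u - v))\<^sup>2 - 2 * t * ((u - v) \<bullet> (w - v)) + t\<^sup>2 * d\<^sup>2"
      unfolding d_def power2_norm_eq_inner
      by (simp add: inner_diff_left inner_diff_right inner_commute power2_eq_square algebra_simps)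
    finally have "2 * t * ((u - v) \<bullet> (w - v)) \<le> t\<^sup>2 * d\<^sup>2 + e'" by simp
    also have "\<dots> \<le> t\<^sup>2 * (2 * real N)\<^sup>2 + e'"
      using d by (intro add_right_mono mult_left_mono power_mono) auto
    also have "\<dots> = 2 * t * e"
      using N_pos by (simp add: t_def e'_def power2_eq_square field_simps)
    finally show ?thesis using t by simp
  qed
  ultimately show ?thesis using \<eta> v(1) Tv(1) by blast
qed

text \<open>From \<open>\<rho> \<eta>\<close> onwards the iterates are \<open>\<eta>\<close>-approximate fixed points in the ball, so the variational
  inequality applies to them; \<open>n = \<rho> \<eta>\<close> translates the tolerance \<open>\<eta>\<close> into an index.\<close>
lemma anchor_along_iterates:
  assumes e: "e > 0" and \<Delta>: "\<And>n. \<Delta> n \<in> {0<..1}"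
  shows "\<exists>n \<le> mu_Psi N \<gamma> \<Gamma>\<^sub>1 \<Gamma>\<^sub>2 \<Gamma>\<^sub>3 \<Gamma>\<^sub>4 e \<Delta>. \<exists>v. norm (v - p) \<le> N \<and> norm (T v - v) \<le> \<Delta> n \<and>
    (\<forall>m\<ge>n. (u - v) \<bullet> (x m - v) \<le> e)"
proof -
  define \<Phi> where "\<Phi> = mu_Phi N e (\<lambda>\<eta>. \<Delta> (\<rho> \<eta>))"
  obtain \<eta> v where \<eta>: "\<eta> \<in> {0<..1}" "0 < \<Phi>" "\<Phi> \<le> \<eta>"
    and v: "norm (v - p) \<le> N" "norm (T v - v) \<le> \<Delta> (\<rho> \<eta>)"
    and var: "\<And>w. norm (w - p) \<le> N \<Longrightarrow> norm (T w - w) \<le> \<eta> \<Longrightarrow> (u - v) \<bullet> (w - v) \<le> e"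
    using approximate_variational_inequality[OF e, of "\<lambda>\<eta>. \<Delta> (\<rho> \<eta>)"] \<Delta> unfolding \<Phi>_def by blast
  have "\<rho> \<eta> \<le> mu_Psi N \<gamma> \<Gamma>\<^sub>1 \<Gamma>\<^sub>2 \<Gamma>\<^sub>3 \<Gamma>\<^sub>4 e \<Delta>"
    unfolding mu_Psi_def using \<eta>(2,3) unfolding \<Phi>_def by (rule \<rho>_anti)
  moreover have "(u - v) \<bullet> (x m - v) \<le> e" if "m \<ge> \<rho> \<eta>" for m
    using that \<eta>(1) by (intro var x_bounded residual_rate) (auto simp: mu_rho_def)
  ultimately show ?thesis using v by blast
qed

section \<open>Metastability\<close>

text \<open>The Mann step moves away from the approximate fixed point \<open>v\<close> by at most \<open>\<delta>\<close>, hence the term \<open>5 N \<delta>\<close> after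
  squaring. The Halpern step contracts towards \<open>v\<close> up to the inner product with the anchor \<open>u\<close>.\<close>
lemma even_distance_step:
  assumes v: "norm (v - p) \<le> N" "norm (T v - v) \<le> \<delta>" and \<delta>: "\<delta> \<le> 1"
    and anchor: "(u - v) \<bullet> (x (2 * k) - v) \<le> e" and \<alpha>_small: "\<alpha> k \<le> e'" and e: "e \<ge> 0"
  shows "(norm (x (2 * Suc k) - v))\<^sup>2
    \<le> (1 - \<alpha> k) * (norm (x (2 * k) - v))\<^sup>2 + \<alpha> k * (2 * e + e' * (9 / 4 * (real N)\<^sup>2)) + 5 * real N * \<delta>"
proof -
  let ?w = "x (2 * k + 1)"
  have \<delta>_nonneg: "0 \<le> \<delta>" using v(2) norm_ge_zero order_trans by blast
  note a = \<alpha>_nonneg[of k] \<alpha>_le[of k]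
  have "x (2 * k + 2) - v = ((1 - b k) *\<^sub>R (T ?w - T v) + b k *\<^sub>R (?w - v)) + (1 - b k) *\<^sub>R (T v - v)"
    by (simp only: mann_step) (simp add: algebra_simps)
  then have "norm (x (2 * k + 2) - v)
      \<le> norm ((1 - b k) *\<^sub>R (T ?w - T v)) + norm (b k *\<^sub>R (?w - v)) + norm ((1 - b k) *\<^sub>R (T v - v))"
    using norm_triangle_ineq norm_triangle_mono by (metis order_refl)
  also have "\<dots> = (1 - b k) * norm (T ?w - T v) + b k * norm (?w - v) + (1 - b k) * norm (T v - v)"
    using b_bounds[of k] by simp
  also have "\<dots> \<le> (1 - b k) * norm (?w - v) + b k * norm (?w - v) + 1 * \<delta>"
    using b_bounds[of k] nonexpansive v(2) by (intro add_mono mult_mono mult_left_mono) auto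
  finally have mann: "norm (x (2 * k + 2) - v) \<le> norm (?w - v) + \<delta>" by (simp add: algebra_simps)
  have w_v: "norm (?w - v) \<le> 2 * N" by (rule ball_dist_le[OF x_bounded v(1)])
  have "(norm (x (2 * k + 2) - v))\<^sup>2 \<le> (norm (?w - v) + \<delta>)\<^sup>2"
    using mann by (intro power_mono) auto
  also have "\<dots> = (norm (?w - v))\<^sup>2 + (2 * norm (?w - v) + \<delta>) * \<delta>"
    by (simp add: power2_eq_square algebra_simps)
  also have "\<dots> \<le> (norm (?w - v))\<^sup>2 + (5 * real N) * \<delta>"
    using w_v \<delta> \<delta>_nonneg N_ge_1 by (intro add_left_mono mult_right_mono) linarith+
  finally have even: "(norm (x (2 * k + 2) - v))\<^sup>2 \<le> (norm (?w - v))\<^sup>2 + 5 * real N * \<delta>" .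
  have "(norm (?w - v))\<^sup>2 = (1 - \<alpha> k)\<^sup>2 * (norm (x (2 * k) - v))\<^sup>2
      + \<alpha> k * (2 * ((1 - \<alpha> k) * ((u - v) \<bullet> (x (2 * k) - v))) + \<alpha> k * (norm (u - v))\<^sup>2)"
    unfolding halpern_step_dist power2_norm_eq_inner
    by (simp only: inner_add_left inner_add_right inner_scaleR_left inner_scaleR_right
        inner_commute[of "x (2 * k) - v" "u - v"]) (simp add: power2_eq_square algebra_simps)
  also have "\<dots> \<le> (1 - \<alpha> k) * (norm (x (2 * k) - v))\<^sup>2 + \<alpha> k * (2 * e + e' * (9 / 4 * (real N)\<^sup>2))"
  proof (intro add_mono mult_left_mono mult_right_mono a)
    show "(1 - \<alpha> k)\<^sup>2 \<le> 1 - \<alpha> k"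
      using a by (simp add: power2_eq_square mult_left_le)
    have "(1 - \<alpha> k) * ((u - v) \<bullet> (x (2 * k) - v)) \<le> (1 - \<alpha> k) * e"
      using anchor a by (intro mult_left_mono) auto
    also have "\<dots> \<le> e" using a e by (simp add: mult_left_le_one_le)
    finally show "(1 - \<alpha> k) * ((u - v) \<bullet> (x (2 * k) - v)) \<le> e" .
    have "(norm (u - v))\<^sup>2 \<le> (3 / 2 * real N)\<^sup>2"
      using anchor_dist_le[OF v(1)] by (intro power_mono) auto
    also have "\<dots> = 9 / 4 * (real N)\<^sup>2" by (simp add: power_mult_distrib power2_eq_square)
    finally show "\<alpha> k * (norm (u - v))\<^sup>2 \<le> e' * (9 / 4 * (real N)\<^sup>2)"
      using \<alpha>_small a by (intro mult_mono) auto
  qed simp_all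
  finally show ?thesis using even by simp
qed

text \<open>The allowance \<open>e = \<epsilon>\<^sup>2 / 16\<close> for \<open>\<parallel>x\<^sub>2\<^sub>k - v\<parallel>\<^sup>2\<close> is spent in three equal parts: on the initial distance
  at the index \<open>K\<close>, damped by the divergence of the sum of the \<open>\<alpha> i\<close>; on the variational inequality and the
  smallness of \<open>\<alpha> k\<close> (the bound \<open>B\<close>); and on the accumulated defects of \<open>v\<close> as a fixed point, at most \<open>P\<close> many. The odd indices
  follow since the Halpern steps are small.\<close>
lemma metastability: "rate_of_metastability (mu N \<gamma> \<Gamma>\<^sub>1 \<Gamma>\<^sub>2 \<Gamma>\<^sub>3 \<Gamma>\<^sub>4) x"
  unfolding rate_of_metastability_def
proof (intro allI impI)
  fix \<epsilon> :: real and f :: "nat \<Rightarrow> nat" assume \<epsilon>: "\<epsilon> > 0"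
  define e where "e = \<epsilon>\<^sup>2 / 16"
  have e: "e > 0" using \<epsilon> by (simp add: e_def)
  define \<Delta> where "\<Delta> = mu_Delta N \<gamma> \<Gamma>\<^sub>1 \<Gamma>\<^sub>2 \<Gamma>\<^sub>3 \<Gamma>\<^sub>4 \<epsilon> f"
  define \<Sigma> where "\<Sigma> = mu_Sigma N \<gamma> \<Gamma>\<^sub>1 \<Gamma>\<^sub>2 \<Gamma>\<^sub>3 \<Gamma>\<^sub>4 \<epsilon>"
  have "\<Delta> n \<in> {0<..1}" for n
    using e N_pos by (auto simp: \<Delta>_def mu_Delta_def simp flip: e_def)
  then obtain n\<^sub>0 v where n\<^sub>0: "n\<^sub>0 \<le> mu_Psi N \<gamma> \<Gamma>\<^sub>1 \<Gamma>\<^sub>2 \<Gamma>\<^sub>3 \<Gamma>\<^sub>4 (e / 24) \<Delta>"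
    and v: "norm (v - p) \<le> N" "norm (T v - v) \<le> \<Delta> n\<^sub>0"
    and anchor: "\<And>m. m \<ge> n\<^sub>0 \<Longrightarrow> (u - v) \<bullet> (x m - v) \<le> e / 24"
    using anchor_along_iterates[of "e / 24" \<Delta>] e by auto
  define n where "n = 2 * max (\<Sigma> n\<^sub>0) (\<theta>\<^sub>4 (\<epsilon> / 4)) + 1"
  \<comment> \<open>No index of the interval \<open>{n..f n}\<close> is reached after more than \<open>P\<close> steps, and \<open>\<Delta> n\<^sub>0\<close> was
    made small relative to \<open>P\<close>.\<close>
  define P where "P = f n"
  define K where "K = max n\<^sub>0 (\<rho>\<^sub>3 (e / (36 * real N)))"
  define L where "L = nat \<lceil>ln (12 * (real N)\<^sup>2 / e)\<rceil>"
  have \<Sigma>: "\<Sigma> n\<^sub>0 = \<Gamma>\<^sub>2 (K + L) + 1"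
    by (simp add: \<Sigma>_def mu_Sigma_def mu_K_def K_def L_def e_def)
  have \<Delta>_n\<^sub>0: "\<Delta> n\<^sub>0 = min (e / (30 * real N * (real P + 1))) 1"
    by (simp add: \<Delta>_def mu_Delta_def mu_P_def P_def n_def \<Sigma>_def e_def)
  have "\<Sigma> n\<^sub>0 \<le> \<Sigma> (mu_Psi N \<gamma> \<Gamma>\<^sub>1 \<Gamma>\<^sub>2 \<Gamma>\<^sub>3 \<Gamma>\<^sub>4 (e / 24) \<Delta>)"
    unfolding \<Sigma>_def mu_Sigma_def mu_K_def using n\<^sub>0
    by (intro add_mono order_refl monoD[OF \<Gamma>\<^sub>2_mono] max.mono)
  then have n_le: "n \<le> mu N \<gamma> \<Gamma>\<^sub>1 \<Gamma>\<^sub>2 \<Gamma>\<^sub>3 \<Gamma>\<^sub>4 \<epsilon> f"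
    unfolding n_def mu_def e_def \<Delta>_def \<Sigma>_def by (intro add_mono mult_le_mono2 max.mono) auto
  have K_small: "\<alpha> k \<le> e / (144 * (real N)\<^sup>2)" if "k \<ge> K" for k
  proof (rule rate_\<alpha>)
    have eq: "e / (36 * real N) / (4 * real N) = e / (144 * (real N)\<^sup>2)"
      by (simp add: power2_eq_square)
    have le: "\<Gamma>\<^sub>1 (e / (36 * real N) / (4 * real N)) \<le> \<rho>\<^sub>3 (e / (36 * real N))"
      unfolding mu_rho3_def by linarith
    have "\<rho>\<^sub>3 (e / (36 * real N)) \<le> k" using that unfolding K_def by simp
    then show "\<Gamma>\<^sub>1 (e / (144 * (real N)\<^sup>2)) \<le> k"
      by (rule order_trans[OF le[unfolded eq]])
  qed (use e N_pos in simp)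
  define B where "B = 2 * (e / 24) + e / (144 * (real N)\<^sup>2) * (9 / 4 * (real N)\<^sup>2)"
  have B: "0 \<le> B" "B \<le> e / 3" using e N_pos by (simp_all add: B_def)
  have even: "norm (x (2 * k) - v) \<le> \<epsilon> / 4" if k: "\<Sigma> n\<^sub>0 \<le> k" "k \<le> P" for k
  proof -
    have "real (K + L) \<le> real (\<Gamma>\<^sub>2 (K + L) + 1)"
      using rate_sum_\<alpha>[of "K + L"] sum_bounded_above[of "{0..\<Gamma>\<^sub>2 (K + L)}" \<alpha> 1] \<alpha>_le by simp
    then have "K \<le> k" using k unfolding \<Sigma> by simp
    then obtain m where m: "k = K + m" using le_Suc_ex by blast
    define s where "s = (\<lambda>j. (norm (x (2 * (K + j)) - v))\<^sup>2)"
    have "s m \<le> exp (- (\<Sum>j<m. \<alpha> (K + j))) * s 0 + B + (\<Sum>j<m. 5 * real N * \<Delta> n\<^sub>0)"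
    proof (rule contracting_recurrence_bound)
      fix j
      have "n\<^sub>0 \<le> 2 * (K + j)" by (simp add: K_def)
      then show "s (Suc j) \<le> (1 - \<alpha> (K + j)) * s j + \<alpha> (K + j) * B + 5 * real N * \<Delta> n\<^sub>0"
        using even_distance_step[OF v _ anchor[of "2 * (K + j)"] K_small[of "K + j"]] e
        by (simp add: s_def B_def \<Delta>_n\<^sub>0)
    qed (use e B N_pos in \<open>auto simp: \<alpha>_nonneg \<alpha>_le s_def \<Delta>_n\<^sub>0\<close>)
    moreover have "exp (- (\<Sum>j<m. \<alpha> (K + j))) * s 0 \<le> e / 3"
    proof -
      have "real L \<le> (\<Sum>j<m. \<alpha> (K + j))"
        using k unfolding \<Sigma> m
        by (intro sum_ge_of_rate_of_divergence[where \<Gamma> = "\<Gamma>\<^sub>2 (K + L)"] \<alpha>_nonneg \<alpha>_le rate_sum_\<alpha>)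
      moreover have "ln (12 * (real N)\<^sup>2 / e) \<le> real L" unfolding L_def by (rule real_nat_ceiling_ge)
      ultimately have "exp (- (\<Sum>j<m. \<alpha> (K + j))) \<le> exp (- ln (12 * (real N)\<^sup>2 / e))" by simp
      also have "\<dots> = e / (12 * (real N)\<^sup>2)" using e N_pos by (simp add: exp_minus)
      finally have "exp (- (\<Sum>j<m. \<alpha> (K + j))) * s 0 \<le> e / (12 * (real N)\<^sup>2) * (2 * real N)\<^sup>2"
        unfolding s_def using ball_dist_le[OF x_bounded v(1)] e by (intro mult_mono power_mono) auto
      then show ?thesis using N_pos by (simp add: power_mult_distrib)
    qed
    moreover have "(\<Sum>j<m. 5 * real N * \<Delta> n\<^sub>0) \<le> e / 3"
    proof -
      have "(\<Sum>j<m. 5 * real N * \<Delta> n\<^sub>0) = real m * (5 * real N * \<Delta> n\<^sub>0)" by simp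
      also have "\<dots> \<le> (real P + 1) * (5 * real N * (e / (30 * real N * (real P + 1))))"
        using k m e N_pos by (intro mult_mono mult_left_mono) (auto simp: \<Delta>_n\<^sub>0)
      also have "\<dots> = e / 6"
      proof -
        have *: "q * (5 * r * (e / (30 * r * q))) = e / 6" if "q > 0" "r > 0" for q r :: real
          using that by (simp add: field_simps)
        show ?thesis by (rule *) (use N_pos in linarith)+
      qed
      finally show ?thesis using e by simp
    qed
    ultimately have "s m \<le> e" using B by simp
    then have "(norm (x (2 * k) - v))\<^sup>2 \<le> (\<epsilon> / 4)\<^sup>2"
      by (simp add: s_def m e_def power_divide)
    then show ?thesis by (rule power2_le_imp_le) (use \<epsilon> in simp)
  qed
  have near: "norm (x i - v) \<le> \<epsilon> / 2" if i: "i \<in> {n..f n}" for i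
  proof (cases "Parity.even i")
    case True
    then obtain k where k: "i = 2 * k" by (elim evenE)
    then have "norm (x (2 * k) - v) \<le> \<epsilon> / 4" using i by (intro even) (auto simp: n_def P_def)
    then show ?thesis using k \<epsilon> by simp
  next
    case False
    then obtain k where k: "i = 2 * k + 1" by (elim oddE)
    then have "norm (x (2 * k) - v) \<le> \<epsilon> / 4" using i by (intro even) (auto simp: n_def P_def)
    moreover have "norm (x (2 * k + 1) - x (2 * k)) \<le> \<epsilon> / 4"
      using \<epsilon> i k by (intro halpern_displacement_rate) (auto simp: n_def)
    ultimately show ?thesis
      using norm_triangle_ineq[of "x (2 * k + 1) - x (2 * k)" "x (2 * k) - v"] k by simp
  qed
  have "norm (x i - x j) \<le> \<epsilon>" if "i \<in> {n..f n}" "j \<in> {n..f n}" for i j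
    using norm_triangle_ineq4[of "x i - v" "x j - v"] near[OF that(1)] near[OF that(2)] by simp
  then show "\<exists>n\<le>mu N \<gamma> \<Gamma>\<^sub>1 \<Gamma>\<^sub>2 \<Gamma>\<^sub>3 \<Gamma>\<^sub>4 \<epsilon> f. \<forall>i\<in>{n..f n}. \<forall>j\<in>{n..f n}. norm (x i - x j) \<le> \<epsilon>"
    using n_le by blast
qed

section \<open>The limit\<close>

lemma limit_fixed:
  assumes "x \<longlonglongrightarrow> q"
  shows "T q = q"
proof -
  have "(\<lambda>n. T (x n) - x n) \<longlonglongrightarrow> 0"
  proof (rule LIMSEQ_I)
    fix r :: real assume "r > 0"
    then have "norm (T (x n) - x n - 0) < r" if "n \<ge> \<rho>\<^sub>2 (r / 2)" for n
      using residual_rate[OF _ that] by simp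
    then show "\<exists>no. \<forall>n\<ge>no. norm (T (x n) - x n - 0) < r" by blast
  qed
  moreover have "(\<lambda>n. T (x n) - x n) \<longlonglongrightarrow> T q - q"
    by (rule tendsto_diff[OF tendsto_nonexpansive[of T, OF nonexpansive assms] assms])
  ultimately show ?thesis using LIMSEQ_unique by fastforce
qed

text \<open>For a fixed point \<open>r\<close>, the increments of \<open>\<parallel>x\<^sub>2\<^sub>k - r\<parallel>\<^sup>2\<close> are at most \<open>\<alpha> k * g k\<close>, where \<open>g k\<close> tends to
  \<open>g\<^sub>0 = \<parallel>u - r\<parallel>\<^sup>2 - \<parallel>u - q\<parallel>\<^sup>2\<close>. A negative \<open>g\<^sub>0\<close> would drive these squares below \<open>0\<close>, because
  the sum of the \<open>\<alpha> k\<close> is infinite.\<close>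
lemma limit_closest:
  assumes lim: "x \<longlonglongrightarrow> q" and r: "T r = r"
  shows "norm (u - q) \<le> norm (u - r)"
proof -
  define s where "s = (\<lambda>k. (norm (x (2 * k) - r))\<^sup>2)"
  define g where "g = (\<lambda>k. 2 * ((u - r) \<bullet> (x (2 * k + 1) - r)) - s k)"
  define g\<^sub>0 where "g\<^sub>0 = 2 * ((u - r) \<bullet> (q - r)) - (norm (q - r))\<^sup>2"
  have step: "s (Suc k) \<le> s k + \<alpha> k * g k" for k
  proof -
    note a = \<alpha>_nonneg[of k] \<alpha>_le[of k]
    have "s (Suc k) \<le> (norm (x (2 * k + 1) - r))\<^sup>2"
      using mann_step_dist_le[OF r, of k] by (simp add: s_def power_mono)
    also have "\<dots> = (1 - \<alpha> k)\<^sup>2 * s k + \<alpha> k * (2 * ((u - r) \<bullet> (x (2 * k + 1) - r))) - (\<alpha> k)\<^sup>2 * (norm (u - r))\<^sup>2"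
      unfolding s_def halpern_step_dist power2_norm_eq_inner
      by (simp only: inner_add_left inner_add_right inner_scaleR_left inner_scaleR_right
          inner_commute[of "x (2 * k) - r" "u - r"]) (simp add: power2_eq_square algebra_simps)
    also have "\<dots> \<le> (1 - \<alpha> k) * s k + \<alpha> k * (2 * ((u - r) \<bullet> (x (2 * k + 1) - r))) - 0"
    proof (intro diff_mono add_mono order_refl mult_right_mono)
      show "(1 - \<alpha> k)\<^sup>2 \<le> 1 - \<alpha> k" using a by (simp add: power2_eq_square mult_left_le)
    qed (simp_all add: s_def)
    finally show ?thesis by (simp add: g_def algebra_simps)
  qed
  have even: "(\<lambda>k. x (2 * k)) \<longlonglongrightarrow> q" and odd: "(\<lambda>k. x (2 * k + 1)) \<longlonglongrightarrow> q"
    using LIMSEQ_subseq_LIMSEQ[OF lim, of "\<lambda>k. 2 * k"] LIMSEQ_subseq_LIMSEQ[OF lim, of "\<lambda>k. 2 * k + 1"]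
    by (simp_all add: strict_mono_def comp_def)
  have g_lim: "g \<longlonglongrightarrow> g\<^sub>0"
    unfolding g_def g\<^sub>0_def s_def by (intro tendsto_intros even odd)
  have "g\<^sub>0 \<ge> 0"
  proof (rule ccontr)
    assume neg: "\<not> g\<^sub>0 \<ge> 0"
    define c where "c = - g\<^sub>0 / 2"
    have c: "c > 0" using neg by (simp add: c_def)
    have "\<forall>\<^sub>F k in sequentially. g k < - c"
      by (rule order_tendstoD(2)[OF g_lim]) (use neg in \<open>simp add: c_def\<close>)
    then obtain K where K: "\<And>k. k \<ge> K \<Longrightarrow> g k < - c"
      by (auto simp: eventually_sequentially)
    have drop: "s (K + m) \<le> s K - c * (\<Sum>k<m. \<alpha> (K + k))" for m
    proof (induction m)
      case (Suc m)
      have "\<alpha> (K + m) * g (K + m) \<le> \<alpha> (K + m) * (- c)"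
        using K[of "K + m"] \<alpha>_nonneg by (intro mult_left_mono) auto
      then show ?case using step[of "K + m"] Suc by (simp add: algebra_simps)
    qed simp
    define L where "L = nat \<lceil>s K / c\<rceil> + 1"
    have "s K / c < real L" unfolding L_def using real_nat_ceiling_ge[of "s K / c"] by linarith
    then have "s K < c * real L" using c by (simp add: field_simps)
    also have "\<dots> \<le> c * (\<Sum>k<\<Gamma>\<^sub>2 (K + L) + 1. \<alpha> (K + k))"
      using c by (intro mult_left_mono sum_ge_of_rate_of_divergence[where \<Gamma> = "\<Gamma>\<^sub>2 (K + L)"]
          \<alpha>_nonneg \<alpha>_le rate_sum_\<alpha>) auto
    finally have "s (K + (\<Gamma>\<^sub>2 (K + L) + 1)) < 0" using drop[of "\<Gamma>\<^sub>2 (K + L) + 1"] by linarith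
    then show False by (simp add: s_def)
  qed
  moreover have "(norm (u - q))\<^sup>2 = (norm (u - r))\<^sup>2 - g\<^sub>0"
    unfolding g\<^sub>0_def power2_norm_eq_inner
    by (simp add: inner_diff_left inner_diff_right inner_commute algebra_simps)
  ultimately have "(norm (u - q))\<^sup>2 \<le> (norm (u - r))\<^sup>2" by simp
  then show ?thesis by (rule power2_le_imp_le) simp
qed

lemma converges_to_projection:
  assumes "x \<longlonglongrightarrow> q"
  shows "metric_projection (Fix T) u = q"
  using limit_fixed[OF assms] limit_closest[OF assms] nonexpansive
  by (intro metric_projection_Fix_eqI) (auto simp: Fix_def)

end

section \<open>The relaxed splitting iteration\<close>

theorem corollary7p5:
  fixes U\<^sub>1 U\<^sub>2 :: "'a::{real_inner, complete_space} \<Rightarrow> 'a set"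
    and c \<gamma> :: real and N :: nat
    and \<alpha> \<beta> :: "nat \<Rightarrow> real"
    and x\<^sub>0 u :: 'a and x y z :: "nat \<Rightarrow> 'a"
    and \<Gamma>\<^sub>1 \<Gamma>\<^sub>3 \<Gamma>\<^sub>4 :: "real \<Rightarrow> nat" and \<Gamma>\<^sub>2 :: "nat \<Rightarrow> nat"
  assumes "maximal_monotone U\<^sub>1" and "maximal_monotone U\<^sub>2" and "c > 0"
    and "\<And>n. \<alpha> n \<in> {0..1}" and "\<And>n. \<beta> n \<in> {-1..1}"
    and "x 0 = x\<^sub>0"
    and "\<And>n. x (2 * n + 1) = (1 - \<alpha> n) *\<^sub>R x (2 * n) + \<alpha> n *\<^sub>R u"
    and "\<And>n. y n = resolvent (scale_op c U\<^sub>2) (x (2 * n + 1))"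
    and "\<And>n. z n = resolvent (scale_op c U\<^sub>1) (2 *\<^sub>R y n - x (2 * n + 1))"
    and "\<And>n. x (2 * n + 2) = x (2 * n + 1) + (1 - \<beta> n) *\<^sub>R (z n - y n)"
    and "antimono_on {0<..} \<Gamma>\<^sub>1" and "mono \<Gamma>\<^sub>2"
    and "antimono_on {0<..} \<Gamma>\<^sub>3" and "antimono_on {0<..} \<Gamma>\<^sub>4"
    and Q1: "\<And>\<epsilon> n. \<epsilon> > 0 \<Longrightarrow> n \<ge> \<Gamma>\<^sub>1 \<epsilon> \<Longrightarrow> \<alpha> n \<le> \<epsilon>"
    and Q2: "\<And>k. (\<Sum>i = 0..\<Gamma>\<^sub>2 k. \<alpha> i) \<ge> real k"
    and Q3: "\<And>\<epsilon> n. \<epsilon> > 0 \<Longrightarrow> (\<Sum>i = \<Gamma>\<^sub>3 \<epsilon> + 1..\<Gamma>\<^sub>3 \<epsilon> + n. \<bar>\<alpha> (i + 1) - \<alpha> i\<bar>) \<le> \<epsilon>"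
    and Q4: "\<And>\<epsilon> n. \<epsilon> > 0 \<Longrightarrow> (\<Sum>i = \<Gamma>\<^sub>4 \<epsilon> + 1..\<Gamma>\<^sub>4 \<epsilon> + n. \<bar>\<beta> (i + 1) - \<beta> i\<bar>) \<le> \<epsilon>"
    and "N \<noteq> 0"
    and "\<exists>p \<in> Fix (reflected_resolvent (scale_op c U\<^sub>1) \<circ> reflected_resolvent (scale_op c U\<^sub>2)).
           real N \<ge> max (norm (x\<^sub>0 - p)) (2 * norm (u - p))"
    and "\<gamma> \<in> {0<..1}" and "\<And>n. -1 + \<gamma> \<le> \<beta> n \<and> \<beta> n \<le> 1 - \<gamma>"
  shows
    "let xbar = metric_projection
           (Fix (reflected_resolvent (scale_op c U\<^sub>1) \<circ> reflected_resolvent (scale_op c U\<^sub>2))) u;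
         \<mu>\<^sub>3 = mu N (\<gamma> / 2) \<Gamma>\<^sub>1 \<Gamma>\<^sub>2 \<Gamma>\<^sub>3 \<Gamma>\<^sub>4;
         \<mu>\<^sub>4 = (\<lambda>\<epsilon> f. \<mu>\<^sub>3 \<epsilon> (\<lambda>n. 2 * f n + 1));
         \<mu>\<^sub>5 = (\<lambda>\<epsilon> f. \<mu>\<^sub>3 (\<epsilon> / 3) (\<lambda>n. 2 * f n + 1))
     in (x \<longlonglongrightarrow> xbar \<and> rate_of_metastability \<mu>\<^sub>3 x) \<and>
        (y \<longlonglongrightarrow> resolvent (scale_op c U\<^sub>2) xbar \<and>
         z \<longlonglongrightarrow> resolvent (scale_op c U\<^sub>2) xbar \<and>
         resolvent (scale_op c U\<^sub>2) xbar \<in> zer (\<lambda>v. U\<^sub>1 v + U\<^sub>2 v) \<and>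
         rate_of_metastability \<mu>\<^sub>4 y \<and> rate_of_metastability \<mu>\<^sub>5 z)"
proof -
  interpret U1: scaled_maximal_monotone U\<^sub>1 c using assms(1,3) by unfold_locales
  interpret U2: scaled_maximal_monotone U\<^sub>2 c using assms(2,3) by unfold_locales
  define T where "T = U1.R \<circ> U2.R"
  define b where "b = (\<lambda>n. (1 + \<beta> n) / 2)"
  define w where "w = (\<lambda>n. x (2 * n + 1))"
  have y: "y n = U2.J (w n)" and z: "z n = U1.J (U2.R (w n))" for n
    using assms(8,9) by (simp_all add: w_def reflected_resolvent_def)
  have T_eq: "T v = v + 2 *\<^sub>R (U1.J (U2.R v) - U2.J v)" for v
    by (simp add: T_def reflected_resolvent_def algebra_simps)
  obtain p where p: "p \<in> Fix T" "norm (x\<^sub>0 - p) \<le> real N" "2 * norm (u - p) \<le> real N"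
    using assms(20) by (auto simp: T_def)
  interpret halpern_mann T p u N "\<gamma> / 2" \<alpha> b x \<Gamma>\<^sub>1 \<Gamma>\<^sub>2 \<Gamma>\<^sub>3 \<Gamma>\<^sub>4
  proof
    show "norm (T v - T v') \<le> norm (v - v')" for v v'
      unfolding T_def comp_def by (rule order_trans[OF U1.R_nonexpansive U2.R_nonexpansive])
    show "T p = p" using p(1) by (simp add: Fix_def)
    show "x (2 * n + 2) = (1 - b n) *\<^sub>R T (x (2 * n + 1)) + b n *\<^sub>R x (2 * n + 1)" for n
    proof -
      have "x (2 * n + 2) = w n + (1 - \<beta> n) *\<^sub>R (z n - y n)" using assms(10) by (simp add: w_def)
      also have "1 - \<beta> n = (1 - b n) * 2" by (simp add: b_def field_simps)
      also have "w n + \<dots> *\<^sub>R (z n - y n) = w n + (1 - b n) *\<^sub>R (2 *\<^sub>R (z n - y n))" by simp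
      also have "2 *\<^sub>R (z n - y n) = T (w n) - w n" by (simp add: T_eq y z)
      finally show ?thesis by (simp add: w_def algebra_simps)
    qed
    show "(\<Sum>i = \<Gamma>\<^sub>4 \<epsilon> + 1..\<Gamma>\<^sub>4 \<epsilon> + n. \<bar>b (i + 1) - b i\<bar>) \<le> \<epsilon>" if "\<epsilon> > 0" for \<epsilon> n
    proof -
      have "(\<Sum>i = \<Gamma>\<^sub>4 \<epsilon> + 1..\<Gamma>\<^sub>4 \<epsilon> + n. \<bar>b (i + 1) - b i\<bar>)
          \<le> (\<Sum>i = \<Gamma>\<^sub>4 \<epsilon> + 1..\<Gamma>\<^sub>4 \<epsilon> + n. \<bar>\<beta> (i + 1) - \<beta> i\<bar>)"
        by (intro sum_mono) (simp add: b_def flip: diff_divide_distrib)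
      also have "\<dots> \<le> \<epsilon>" using Q4[OF that] .
      finally show ?thesis .
    qed
    show "\<gamma> / 2 \<le> b n" "b n \<le> 1 - \<gamma> / 2" for n
      using assms(22)[of n] by (simp_all add: b_def field_simps)
    show "\<epsilon> > 0 \<Longrightarrow> (\<Sum>i = \<Gamma>\<^sub>3 \<epsilon> + 1..\<Gamma>\<^sub>3 \<epsilon> + n. \<bar>\<alpha> (i + 1) - \<alpha> i\<bar>) \<le> \<epsilon>" for \<epsilon> n
      by (rule Q3)
    show "x (2 * n + 1) = (1 - \<alpha> n) *\<^sub>R x (2 * n) + \<alpha> n *\<^sub>R u" for n by (rule assms(7))
    show "0 < N" "0 < \<gamma> / 2" using assms(19,21) by simp_all
    show "norm (x 0 - p) \<le> real N" using p(2) assms(6) by simp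
    show "2 * norm (u - p) \<le> real N" by (rule p(3))
    show "0 \<le> \<alpha> n" "\<alpha> n \<le> 1" for n using assms(4)[of n] by simp_all
    show "antimono_on {0<..} \<Gamma>\<^sub>1" by (rule assms(11))
    show "mono \<Gamma>\<^sub>2" by (rule assms(12))
    show "antimono_on {0<..} \<Gamma>\<^sub>3" by (rule assms(13))
    show "antimono_on {0<..} \<Gamma>\<^sub>4" by (rule assms(14))
    show "\<alpha> n \<le> \<epsilon>" if "\<epsilon> > 0" "n \<ge> \<Gamma>\<^sub>1 \<epsilon>" for \<epsilon> n using that by (rule Q1)
    show "(\<Sum>i = 0..\<Gamma>\<^sub>2 k. \<alpha> i) \<ge> real k" for k by (rule Q2)
  qed
  obtain q where q: "x \<longlonglongrightarrow> q"
    using rate_of_metastability_imp_Cauchy[OF metastability] Cauchy_convergent convergent_def by blast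
  have xbar: "metric_projection (Fix (U1.R \<circ> U2.R)) u = q"
    using converges_to_projection[OF q] by (simp add: T_def)
  have w_lim: "w \<longlonglongrightarrow> q"
    using LIMSEQ_subseq_LIMSEQ[OF q, of "\<lambda>n. 2 * n + 1"]
    by (simp add: strict_mono_def comp_def w_def)
  \<comment> \<open>At a fixed point of \<open>T\<close> the two resolvents take the same value, so \<open>y\<close> and \<open>z\<close> share their limit,
    and the two resolvent inclusions add up to the inclusion for the sum.\<close>
  have J_eq: "U1.J (U2.R q) = U2.J q"
    using limit_fixed[OF q] unfolding T_eq by simp
  have J1R2: "norm (U1.J (U2.R v) - U1.J (U2.R v')) \<le> norm (v - v')" for v v'
    by (rule order_trans[OF U1.J_nonexpansive U2.R_nonexpansive])
  have "y \<longlonglongrightarrow> U2.J q"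
    using tendsto_nonexpansive[of U2.J, OF U2.J_nonexpansive w_lim] by (simp add: y[abs_def])
  moreover have "z \<longlonglongrightarrow> U2.J q"
    using tendsto_nonexpansive[of "\<lambda>v. U1.J (U2.R v)", OF J1R2 w_lim] by (simp add: z[abs_def] J_eq)
  moreover have "U2.J q \<in> zer (\<lambda>v. U\<^sub>1 v + U\<^sub>2 v)"
  proof -
    have "U2.R q - U2.J q \<in> scale_op c U\<^sub>1 (U2.J q)"
      using U1.resolvent_mem[of "U2.R q"] by (simp add: J_eq)
    then obtain a where a: "a \<in> U\<^sub>1 (U2.J q)" "U2.J q - q = c *\<^sub>R a"
      by (auto simp: scale_op_def reflected_resolvent_def scaleR_2)
    obtain a' where a': "a' \<in> U\<^sub>2 (U2.J q)" "q - U2.J q = c *\<^sub>R a'"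
      using U2.resolvent_mem[of q] by (auto simp: scale_op_def)
    have "c *\<^sub>R (a + a') = (U2.J q - q) + (q - U2.J q)" by (simp only: a a' scaleR_add_right)
    then have "a + a' = 0" using U1.c_pos by simp
    then show ?thesis unfolding zer_def using set_plus_intro[OF a(1) a'(1)] by simp
  qed
  moreover have "rate_of_metastability (\<lambda>\<epsilon> f. mu N (\<gamma> / 2) \<Gamma>\<^sub>1 \<Gamma>\<^sub>2 \<Gamma>\<^sub>3 \<Gamma>\<^sub>4 \<epsilon> (\<lambda>n. 2 * f n + 1)) y"
    by (rule rate_of_metastability_nonexpansive_odd[OF metastability])
      (use U2.J_nonexpansive in \<open>simp add: y w_def\<close>)
  moreover have "rate_of_metastability (\<lambda>\<epsilon> f. mu N (\<gamma> / 2) \<Gamma>\<^sub>1 \<Gamma>\<^sub>2 \<Gamma>\<^sub>3 \<Gamma>\<^sub>4 (\<epsilon> / 3) (\<lambda>n. 2 * f n + 1)) z"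
    by (rule rate_of_metastability_smaller_precision, rule rate_of_metastability_nonexpansive_odd[OF metastability])
      (use J1R2 in \<open>simp_all add: z w_def\<close>)
  ultimately show ?thesis
    using q metastability by (simp only: Let_def xbar simp_thms)
qed

end
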